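(* For every $x\in E$, $$\lim_{h\to0}\Bigl|\inf_{V\in\mathbb V_h}J^d_h(x,V)-\inf_{V\in\mathbb V_h}J^d(x,V)\Bigr|=0.$$
   Context: Process. $X=(X_t)_{t\ge0}$ is a continuous-time standard Feller–Markov process on a filtered space $(\Omega,\mathcal F,(\mathcal F_t))$ (standard in the usual sense of Markov process theory) with values in a compact metric space $(E,\rho)$ with Borel $\sigma$-field $\mathcal E$; $\mathbb P_x,\mathbb E_x$ are the law and expectation for the process started at $x\in E$, and $P_t(x,A):=\mathbb P_x[X_t\in A]$. The set of admissible after-impulse states is $U=E$. $\mathcal C_b(E)$ is the space of bounded continuous real functions on $E$; $\mathbb N=\{0,1,2,\dots\}$. Standing assumptions. (1) $\beta:[0,\infty)\to(0,1]$ is weakly decreasing and continuous, $\beta(0)=1$, $\beta(t+s)\ge\beta(t)\beta(s)$ for all $t,s\ge0$, and $\int_0^\infty\beta(s)ds=\infty$. (2) $g:E\to\mathbb R$ is continuous and bounded; $c:E\times U\to\mathbb R_+$ is continuous and bounded, and for some $c_0>0$ we have $0<c_0\le c(x,\xi)\le c(x,\eta)+c(\eta,\xi)$ for $x,\xi,\eta\in E$. (3) For every $f\in\mathcal C_b(E)$ and $t>0$, the map $x\mapsto\mathbb E_x[f(X_t)]$ is in $\mathcal C_b(E)$. (4) For every $t>0$ there is $\Lambda_t\in(0,1)$ with $\sup_{x,y\in E}\sup_{A\in\mathcal E}|P_t(x,A)-P_t(y,A)|\le\Lambda_t$. Impulse control. A strategy is a sequence $V=(\tau_i,\xi_i)_{i=1}^\infty$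 with $(\tau_i)$ an increasing (weakly, values in $[0,\infty]$) sequence of stopping times and $\xi_i$ $\mathcal F_{\tau_i}$-measurable $U$-valued random variables; $\mathbb V$ is the family of all strategies, and for $h>0$, $\mathbb V_h\subset\mathbb V$ consists of those with impulse times restricted to $\{0,h,2h,\dots\}$ (or $\infty$, i.e. no impulse). On a countable product of copies of $(\Omega,\mathcal F,(\mathcal F_t))$ with coordinate process $(X^1_t,X^2_t,\dots)$, to each $x\in E$ and $V\in\mathbb V$ one associates a probability $\mathbb P^V_x$ (expectation $\mathbb E^V_x$) under which $X^1$ follows the uncontrolled dynamics from $x$ and, for each $i\ge1$, on $\{\tau_i<\infty\}$, $X^{i+1}_{\tau_i}=\xi_i$ and from time $\tau_i$ on $X^{i+1}$ follows the uncontrolled dynamics started afresh from $\xi_i$ (conditionally on the past). The controlled process is $Y_t:=X^i_t$ for $t\in[\tau_{i-1},\tau_i)$, $\tau_0\equiv0$. Functionals. For $x\in E$ and $V\in\mathbb V$, $$J^d(x,V):=\limsup_{T\to\infty}\frac{\mathbb E^V_x\bigl[\int_0^T\beta(s)g(Y_s)ds+\sum_{i=1}^\infty1_{\{\tau_i\le T\}}\beta(\tau_i)c(X^i_{\tau_i},X^{i+1}_{\tau_i})\bigr]}{\int_0^T\beta(s)ds},$$ and, for $V\in\mathbb V_h$, with $\varphi_h(i):=\frac1h\int_{ih}^{(i+1)h}\beta(s)ds$, $i\in\mathbb N$, $$J^d_h(x,V):=\limsup_{n\to\infty}\frac{\mathbb E^V_x\bigl[\sum_{i=0}^{n-1}\varphi_h(i)g(Y_{ih})+\sum_{i=1}^\infty1_{\{\tau_i\le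 nh\}}\frac1h\varphi_h(\tau_i/h)c(X^i_{\tau_i},X^{i+1}_{\tau_i})\bigr]}{\sum_{i=0}^{n-1}\varphi_h(i)}.$$ *)

theory Defs
  imports "HOL-Probability.Probability"
begin

section \<open>Standard Markov processes\<close>

definition transition ::
  "(real \<Rightarrow> 'w \<Rightarrow> 'e) \<Rightarrow> ('e \<Rightarrow> 'w measure) \<Rightarrow> real \<Rightarrow> 'e \<Rightarrow> 'e set \<Rightarrow> real" where
  "transition X P t x A = measure (P x) {\<omega> \<in> space (P x). X t \<omega> \<in> A}"

text \<open>
  The filtration is indexed by \<open>[0,\<infinity>]\<close>, so that the library's stopping times may take the
  value \<open>\<infinity>\<close>; \<open>F \<infinity>\<close> is the ambient \<open>\<sigma>\<close>-algebra on \<open>\<Omega>\<close>. The process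
  \<open>X\<close> itself is indexed by reals and only its values at times \<open>t \<ge> 0\<close> matter. Lifetimes are
  infinite (there is no cemetery state).

  The filtration is right-continuous but not required to be complete, so complete filtrations are
  covered. Completeness is not imposed because on the countable product below the law of a
  restarted copy need not be absolutely continuous with respect to the laws \<open>P x\<close>; it then cannot,
  in general, be defined on a \<open>\<sigma>\<close>-algebra containing all sets that are null for every \<open>P x\<close>.

  The ordinary Markov property is \<open>strong_Markov\<close> for constant \<open>T\<close>.
\<close>

locale standard_process = filtration "space (F \<infinity>)" F
  for F :: "ennreal \<Rightarrow> 'w measure" +
  fixes X :: "real \<Rightarrow> 'w \<Rightarrow> 'e::{metric_space, second_countable_topology}"
    and \<theta> :: "real \<Rightarrow> 'w \<Rightarrow> 'w"
    and P :: "'e \<Rightarrow> 'w measure"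
  assumes right_continuous_filtration:
      "\<And>t. t < \<infinity> \<Longrightarrow> sets (F t) = (\<Inter>s\<in>{t<..}. sets (F s))"
    and adapted: "\<And>t. 0 \<le> t \<Longrightarrow> X t \<in> F (ennreal t) \<rightarrow>\<^sub>M borel"
    and right_continuous_paths:
      "\<And>\<omega> t. \<omega> \<in> space (F \<infinity>) \<Longrightarrow> 0 \<le> t \<Longrightarrow> continuous (at_right t) (\<lambda>s. X s \<omega>)"
    and left_limits:
      "\<And>\<omega> t. \<omega> \<in> space (F \<infinity>) \<Longrightarrow> 0 < t \<Longrightarrow> \<exists>l. ((\<lambda>s. X s \<omega>) \<longlongrightarrow> l) (at_left t)"
    and shift_space: "\<And>\<omega> t. \<omega> \<in> space (F \<infinity>) \<Longrightarrow> 0 \<le> t \<Longrightarrow> \<theta> t \<omega> \<in> space (F \<infinity>)"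
    and shift: "\<And>\<omega> s t. \<omega> \<in> space (F \<infinity>) \<Longrightarrow> 0 \<le> s \<Longrightarrow> 0 \<le> t \<Longrightarrow> X s (\<theta> t \<omega>) = X (s + t) \<omega>"
    and kernel: "P \<in> borel \<rightarrow>\<^sub>M prob_algebra (F \<infinity>)"
    and normal: "\<And>x. AE \<omega> in P x. X 0 \<omega> = x"
    and strong_Markov:
      "\<And>x T t A. stopping_time F T \<Longrightarrow> 0 \<le> t \<Longrightarrow> A \<in> sets borel \<Longrightarrow>
        AE \<omega> in P x. T \<omega> < \<infinity> \<longrightarrow>
          real_cond_exp (P x) (pre_sigma T)
            (\<lambda>\<omega>. indicator A (X (enn2real (T \<omega>) + t) \<omega>)) \<omega>
          = transition X P t (X (enn2real (T \<omega>)) \<omega>) A"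
    and quasi_left_continuous:
      "\<And>x S. (\<And>n. stopping_time F (S n)) \<Longrightarrow>
        (\<And>n \<omega>. \<omega> \<in> space (F \<infinity>) \<Longrightarrow> S n \<omega> \<le> S (Suc n) \<omega>) \<Longrightarrow>
        AE \<omega> in P x. (SUP n. S n \<omega>) < \<infinity> \<longrightarrow>
          (\<lambda>n. X (enn2real (S n \<omega>)) \<omega>) \<longlonglongrightarrow> X (enn2real (SUP n. S n \<omega>)) \<omega>"

section \<open>Impulse strategies\<close>

text \<open>
  All sequences start at \<open>0\<close>: in the usual notation \<open>\<tau>\<^sub>1, \<tau>\<^sub>2, \<dots>\<close> and \<open>X\<^sup>1, X\<^sup>2, \<dots>\<close>, the pair
  \<open>V i\<close> is \<open>(\<tau>\<^bsub>i+1\<^esub>, \<xi>\<^bsub>i+1\<^esub>)\<close>, and \<open>X t (w i)\<close> is \<open>X\<^bsup>i+1\<^esup>\<close> at time \<open>t\<close> for a point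
  \<open>w\<close> of the product space. The value \<open>\<infinity>\<close> of an impulse time means that there is no impulse.
\<close>

type_synonym ('w, 'e) strategy = "nat \<Rightarrow> ((nat \<Rightarrow> 'w) \<Rightarrow> ennreal) \<times> ((nat \<Rightarrow> 'w) \<Rightarrow> 'e)"

abbreviation imp_time :: "('w, 'e) strategy \<Rightarrow> nat \<Rightarrow> (nat \<Rightarrow> 'w) \<Rightarrow> ennreal" where
  "imp_time V i \<equiv> fst (V i)"

abbreviation imp_state :: "('w, 'e) strategy \<Rightarrow> nat \<Rightarrow> (nat \<Rightarrow> 'w) \<Rightarrow> 'e" where
  "imp_state V i \<equiv> snd (V i)"

abbreviation seq_space :: "(ennreal \<Rightarrow> 'w measure) \<Rightarrow> (nat \<Rightarrow> 'w) measure" where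
  "seq_space F \<equiv> Pi\<^sub>M UNIV (\<lambda>_. F \<infinity>)"

text \<open>
  The \<open>\<sigma>\<close>-algebra \<open>F\<^sub>t \<otimes> \<dots> \<otimes> F\<^sub>t\<close> of the coordinates \<open>0, \<dots>, n\<close>, regarded as a
  \<open>\<sigma>\<close>-algebra on the whole product space.
\<close>

definition seq_filtration ::
  "(ennreal \<Rightarrow> 'w measure) \<Rightarrow> nat \<Rightarrow> ennreal \<Rightarrow> (nat \<Rightarrow> 'w) measure" where
  "seq_filtration F n t =
    vimage_algebra (space (seq_space F)) (\<lambda>w. restrict w {..n}) (Pi\<^sub>M {..n} (\<lambda>_. F t))"

abbreviation seq_pre_sigma ::
  "(ennreal \<Rightarrow> 'w measure) \<Rightarrow> nat \<Rightarrow> ((nat \<Rightarrow> 'w) \<Rightarrow> ennreal) \<Rightarrow> (nat \<Rightarrow> 'w) measure" where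
  "seq_pre_sigma F n \<equiv> filtration.pre_sigma (space (seq_space F)) (seq_filtration F n)"

text \<open>
  The decision on an impulse is based on the observation of the current copy and of the previous
  ones.
\<close>

definition strategies :: "(ennreal \<Rightarrow> 'w measure) \<Rightarrow> ('w, 'e::metric_space) strategy set" where
  "strategies F = {V.
    (\<forall>i. stopping_time (seq_filtration F i) (imp_time V i)) \<and>
    (\<forall>i. \<forall>w\<in>space (seq_space F). imp_time V i w \<le> imp_time V (Suc i) w) \<and>
    (\<forall>i. imp_state V i \<in> seq_pre_sigma F i (imp_time V i) \<rightarrow>\<^sub>M borel)}"

definition grid_strategies ::
  "(ennreal \<Rightarrow> 'w measure) \<Rightarrow> real \<Rightarrow> ('w, 'e::metric_space) strategy set" where
  "grid_strategies F h = {V \<in> strategies F.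
    \<forall>i. \<forall>w\<in>space (seq_space F). imp_time V i w \<in> insert \<infinity> {ennreal (real k * h) | k. True}}"

text \<open>
  \<open>controlled_law F X P x V Q\<close>: the probability \<open>Q\<close> on the product space describes the process
  started at \<open>x\<close> and controlled by \<open>V\<close>. The last clause states that on the event that the \<open>i\<close>-th
  impulse time \<open>\<tau>\<close> is finite, the next copy observed from time \<open>\<tau>\<close> on is a Markov process with the
  uncontrolled transition function, relative to the past (at times \<open>\<tau> + s\<close>) of all the copies
  used up to then. The behaviour of that copy before time \<open>\<tau>\<close> is left unspecified.
\<close>

definition controlled_law ::
  "(ennreal \<Rightarrow> 'w measure) \<Rightarrow> (real \<Rightarrow> 'w \<Rightarrow> 'e::metric_space) \<Rightarrow> ('e \<Rightarrow> 'w measure) \<Rightarrow>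
   'e \<Rightarrow> ('w, 'e) strategy \<Rightarrow> (nat \<Rightarrow> 'w) measure \<Rightarrow> bool" where
  "controlled_law F X P x V Q \<longleftrightarrow>
    prob_space Q \<and> sets Q = sets (seq_space F) \<and>
    distr Q (F \<infinity>) (\<lambda>w. w 0) = P x \<and>
    (\<forall>i. AE w in Q. imp_time V i w < \<infinity> \<longrightarrow>
       X (enn2real (imp_time V i w)) (w (Suc i)) = imp_state V i w) \<and>
    (\<forall>i. \<forall>s\<ge>0. \<forall>t\<ge>0. \<forall>A\<in>sets borel. AE w in Q. imp_time V i w < \<infinity> \<longrightarrow>
       real_cond_exp Q (seq_pre_sigma F (Suc i) (\<lambda>w. imp_time V i w + ennreal s))
         (\<lambda>w. indicator A (X (enn2real (imp_time V i w) + s + t) (w (Suc i)))) w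
       = transition X P t (X (enn2real (imp_time V i w) + s) (w (Suc i))) A)"

text \<open>
  The second case only occurs after an accumulation point of impulse times; the cost functionals
  below are infinite if this happens with positive probability.
\<close>

definition controlled ::
  "(real \<Rightarrow> 'w \<Rightarrow> 'e) \<Rightarrow> ('w, 'e) strategy \<Rightarrow> real \<Rightarrow> (nat \<Rightarrow> 'w) \<Rightarrow> 'e" where
  "controlled X V t w =
    (if \<exists>j. ennreal t < imp_time V j w
     then X t (w (LEAST j. ennreal t < imp_time V j w)) else X t (w 0))"

definition imp_cost ::
  "('e \<Rightarrow> 'e \<Rightarrow> real) \<Rightarrow> (real \<Rightarrow> 'w \<Rightarrow> 'e) \<Rightarrow> ('w, 'e) strategy \<Rightarrow> nat \<Rightarrow> (nat \<Rightarrow> 'w) \<Rightarrow> real" where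
  "imp_cost c X V i w =
    c (X (enn2real (imp_time V i w)) (w i)) (X (enn2real (imp_time V i w)) (w (Suc i)))"

section \<open>Long-run functionals\<close>

definition ereal_expectation :: "'a measure \<Rightarrow> ('a \<Rightarrow> ereal) \<Rightarrow> ereal" where
  "ereal_expectation Q Z =
    enn2ereal (\<integral>\<^sup>+ w. e2ennreal (Z w) \<partial>Q) - enn2ereal (\<integral>\<^sup>+ w. e2ennreal (- Z w) \<partial>Q)"

definition J_d ::
  "(real \<Rightarrow> real) \<Rightarrow> ('e \<Rightarrow> real) \<Rightarrow> ('e \<Rightarrow> 'e \<Rightarrow> real) \<Rightarrow> (real \<Rightarrow> 'w \<Rightarrow> 'e) \<Rightarrow>
   ('e \<Rightarrow> ('w, 'e) strategy \<Rightarrow> (nat \<Rightarrow> 'w) measure) \<Rightarrow> 'e \<Rightarrow> ('w, 'e) strategy \<Rightarrow> ereal" where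
  "J_d \<beta> g c X PV x V = Limsup at_top (\<lambda>T::real.
    ereal_expectation (PV x V) (\<lambda>w.
      ereal (LINT s:{0..T}|lborel. \<beta> s * g (controlled X V s w)) +
      (\<Sum>i. if imp_time V i w \<le> ennreal T
            then ereal (\<beta> (enn2real (imp_time V i w)) * imp_cost c X V i w) else 0))
    / ereal (LINT s:{0..T}|lborel. \<beta> s))"

text \<open>The argument \<open>u\<close> is real so that \<open>\<phi>\<^sub>h(\<tau>\<^sub>i/h)\<close> can be written without rounding.\<close>

definition phi :: "(real \<Rightarrow> real) \<Rightarrow> real \<Rightarrow> real \<Rightarrow> real" where
  "phi \<beta> h u = (1 / h) * (LINT s:{u * h..(u + 1) * h}|lborel. \<beta> s)"

definition J_d_grid ::
  "(real \<Rightarrow> real) \<Rightarrow> ('e \<Rightarrow> real) \<Rightarrow> ('e \<Rightarrow> 'e \<Rightarrow> real) \<Rightarrow> (real \<Rightarrow> 'w \<Rightarrow> 'e) \<Rightarrow>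
   ('e \<Rightarrow> ('w, 'e) strategy \<Rightarrow> (nat \<Rightarrow> 'w) measure) \<Rightarrow> real \<Rightarrow> 'e \<Rightarrow> ('w, 'e) strategy \<Rightarrow> ereal" where
  "J_d_grid \<beta> g c X PV h x V = limsup (\<lambda>n.
    ereal_expectation (PV x V) (\<lambda>w.
      ereal (\<Sum>i<n. phi \<beta> h (real i) * g (controlled X V (real i * h) w)) +
      (\<Sum>i. if imp_time V i w \<le> ennreal (real n * h)
            then ereal ((1 / h) * phi \<beta> h (enn2real (imp_time V i w) / h) * imp_cost c X V i w)
            else 0))
    / ereal (\<Sum>i<n. phi \<beta> h (real i)))"

end

theory Submission
  imports Defs
begin

text \<open>
  Let \<open>B(T)\<close> be the integral of \<open>\<beta>\<close> over \<open>[0, T]\<close> and \<open>\<bar>g\<bar> \<le> M\<close>. The weights \<open>h \<phi>\<^sub>h(i)\<close> are the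
  increments of \<open>B\<close> along the grid, so expanding the fraction in \<open>J\<^sup>d\<^sub>h\<close> by \<open>h\<close> turns its denominator
  into \<open>B(nh)\<close>, the denominator of \<open>J\<^sup>d\<close> at \<open>T = nh\<close>. For a fixed grid strategy it remains to compare
  the numerators, and they differ in three ways.

  Impulse costs. Monotonicity and \<open>\<beta>(t + s) \<ge> \<beta>(t) \<beta>(s)\<close> give
  \<open>\<beta>(h) \<beta>(\<tau>) \<le> \<phi>\<^sub>h(\<tau>/h) \<le> \<beta>(\<tau>)\<close> (\<open>phi_bounds\<close>), so the two impulse costs agree up to a factor in
  \<open>[\<beta>(h), 1]\<close>, and this interval shrinks to \<open>{1}\<close>.

  Running gain. Between two grid times the controlled process moves like the uncontrolled one
  (\<open>Markov_grid\<close>); hence \<open>E g(Y\<^sub>s)\<close> differs from its value at the preceding grid time by at most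
  \<open>\<delta> = sup\<^bsub>s \<le> h\<^esub> \<parallel>P\<^sub>s g - g\<parallel>\<close>, and the running gains differ by at most \<open>\<delta> B(nh)\<close>
  (\<open>gain_grid_gain\<close>). That \<open>\<delta> \<rightarrow> 0\<close> as \<open>h \<rightarrow> 0\<close> is the strong continuity of a Feller semigroup on a
  compact space (\<open>semigroup_uniformly_continuous\<close>), which is proved from the right-continuity of paths.

  Times off the grid. There are no impulses strictly between grid times, and since \<open>B(T) \<rightarrow> \<infinity>\<close> the
  running gain over less than one step is negligible.

  A multiplicative error of the impulse cost is harmless: adding \<open>M\<close> makes the averages nonnegative,
  so \<open>\<beta>(h) (J\<^sup>d + M) \<le> J\<^sup>d\<^sub>h + M + \<delta>\<close> and \<open>J\<^sup>d\<^sub>h \<le> J\<^sup>d + \<delta>\<close> up to an arbitrarily small error. The strategy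
  without impulses shows that the infimum of \<open>J\<^sup>d\<^sub>h\<close> lies in \<open>[- M, M]\<close>, so the infima differ by at
  most \<open>2 M (1/\<beta>(h) - 1)\<close> plus a multiple of \<open>\<delta>\<close> (\<open>grid_values_close\<close>).

  The comparison of running gains needs almost surely finitely many impulses in bounded time. Every
  impulse before \<open>T\<close> costs at least \<open>c\<^sub>0 \<beta>(T)\<close>, so this holds whenever the expected cost is finite
  (\<open>finitely_many_impulses\<close>), and otherwise both functionals are infinite.
\<close>

section \<open>Two measure-theoretic tools\<close>

text \<open>
  The process is the pointwise limit of its values at the grid times
  \<open>(\<lfloor>t (n + 1)\<rfloor> + 1) / (n + 1)\<close>, which approach \<open>t\<close> strictly from the right. The truncation
  \<open>max 0 t\<close> is there because nothing is known about the process at negative times.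
\<close>

lemma borel_measurable_right_continuous:
  fixes Z :: "real \<Rightarrow> 'a \<Rightarrow> 'b::metric_space"
  assumes Z: "\<And>t. 0 \<le> t \<Longrightarrow> Z t \<in> borel_measurable M"
    and cont: "\<And>\<omega> t. \<omega> \<in> space M \<Longrightarrow> 0 \<le> t \<Longrightarrow> continuous (at_right t) (\<lambda>s. Z s \<omega>)"
  shows "(\<lambda>(t, \<omega>). Z (max 0 t) \<omega>) \<in> borel_measurable (borel \<Otimes>\<^sub>M M)"
proof -
  define k where "k n t = nat \<lfloor>max 0 t * real (Suc n)\<rfloor>" for n and t :: real
  define s where "s n t = (real (k n t) + 1) / real (Suc n)" for n t
  show ?thesis
  proof (rule borel_measurable_LIMSEQ_metric[where f="\<lambda>n (t, \<omega>). Z (s n t) \<omega>"])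
    show "(\<lambda>(t, \<omega>). Z (s n t) \<omega>) \<in> borel_measurable (borel \<Otimes>\<^sub>M M)" for n
    proof -
      have "(\<lambda>p. (\<lambda>i p. Z ((real i + 1) / real (Suc n)) (snd p)) (k n (fst p)) p)
        \<in> borel_measurable (borel \<Otimes>\<^sub>M M)"
      proof (rule measurable_compose_countable[where f="\<lambda>i p. Z ((real i + 1) / real (Suc n)) (snd p)"])
        show "(\<lambda>p. Z ((real i + 1) / real (Suc n)) (snd p)) \<in> borel_measurable (borel \<Otimes>\<^sub>M M)" for i
          by (rule measurable_compose[OF measurable_snd Z]) simp
        show "(\<lambda>p. k n (fst p)) \<in> borel \<Otimes>\<^sub>M M \<rightarrow>\<^sub>M count_space UNIV"
          unfolding k_def by measurable
      qed
      then show ?thesis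
        by (simp add: s_def case_prod_beta')
    qed
    fix p :: "real \<times> 'a" assume p: "p \<in> space (borel \<Otimes>\<^sub>M M)"
    obtain t \<omega> where p_eq: "p = (t, \<omega>)" and \<omega>: "\<omega> \<in> space M"
      using p by (auto simp: space_pair_measure)
    define u where "u = max 0 t"
    have s_eq: "s n t = (real_of_int \<lfloor>u * real (Suc n)\<rfloor> + 1) / real (Suc n)" for n
      by (simp add: s_def k_def u_def)
    have gt: "u < s n t" for n
      unfolding s_eq by (subst pos_less_divide_eq) linarith+
    have le: "s n t \<le> u + 1 / real (Suc n)" for n
    proof -
      have "s n t \<le> (u * real (Suc n) + 1) / real (Suc n)"
        unfolding s_eq by (intro divide_right_mono) auto
      then show ?thesis by (simp add: add_divide_distrib del: of_nat_Suc)
    qed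
    have "(\<lambda>n. s n t) \<longlonglongrightarrow> u"
    proof (rule tendsto_sandwich[OF _ _ tendsto_const])
      show "(\<lambda>n. u + 1 / real (Suc n)) \<longlonglongrightarrow> u"
        using tendsto_add[OF tendsto_const lim_1_over_n[THEN LIMSEQ_Suc], of u] by simp
      show "\<forall>\<^sub>F n in sequentially. u \<le> s n t"
        using gt by (simp add: less_imp_le)
      show "\<forall>\<^sub>F n in sequentially. s n t \<le> u + 1 / real (Suc n)"
        by (intro always_eventually allI le)
    qed
    then have "filterlim (\<lambda>n. s n t) (at_right u) sequentially"
      using gt by (intro tendsto_imp_filterlim_at_right) auto
    moreover have "((\<lambda>r. Z r \<omega>) \<longlongrightarrow> Z u \<omega>) (at_right u)"
      using cont[OF \<omega>, of u] by (simp add: continuous_within u_def)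
    ultimately show "(\<lambda>n. (case p of (t, \<omega>) \<Rightarrow> Z (s n t) \<omega>)) \<longlonglongrightarrow> (case p of (t, \<omega>) \<Rightarrow> Z (max 0 t) \<omega>)"
      unfolding p_eq u_def prod.case by (rule filterlim_compose[rotated])
  qed
qed

text \<open>
  The identity for indicators says that the law of \<open>W\<close> is the mixture of the kernel \<open>K\<close> over the law
  of \<open>U\<close>; the integral with respect to a mixture is the iterated integral.
\<close>

lemma integral_eq_kernel:
  fixes f :: "'b \<Rightarrow> real"
  assumes Q: "prob_space Q"
    and W: "W \<in> Q \<rightarrow>\<^sub>M N" and U: "U \<in> Q \<rightarrow>\<^sub>M L" and K: "K \<in> L \<rightarrow>\<^sub>M prob_algebra N"
    and eq: "\<And>A. A \<in> sets N \<Longrightarrow>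
      (\<integral>w. indicator A (W w) \<partial>Q) = (\<integral>w. measure (K (U w)) A \<partial>Q)"
    and f: "f \<in> borel_measurable N" and bounded: "\<And>y. y \<in> space N \<Longrightarrow> \<bar>f y\<bar> \<le> C"
  shows "(\<integral>w. f (W w) \<partial>Q) = (\<integral>w. (\<integral>y. f y \<partial>K (U w)) \<partial>Q)"
proof -
  interpret Q: prob_space Q by fact
  note [measurable] = W U K f
  have KU: "(\<lambda>w. K (U w)) \<in> Q \<rightarrow>\<^sub>M prob_algebra N" by measurable
  note KU' = measurable_prob_algebraD[OF KU]
  have KUs: "prob_space (K (U w))" "sets (K (U w)) = sets N" if "w \<in> space Q" for w
    using measurable_space[OF KU that] by (auto simp: space_prob_algebra)
  have "distr Q N W = Q \<bind> (\<lambda>w. K (U w))"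
  proof (rule measure_eqI)
    show "sets (distr Q N W) = sets (Q \<bind> (\<lambda>w. K (U w)))"
      using KUs(2) by (subst sets_bind[where N=N]) (auto simp: Q.not_empty)
    fix A assume "A \<in> sets (distr Q N W)"
    then have A[measurable]: "A \<in> sets N" by simp
    have "emeasure (distr Q N W) A = emeasure Q (W -` A \<inter> space Q)"
      by (simp add: emeasure_distr)
    also have "\<dots> = ennreal (\<integral>w. indicator A (W w) \<partial>Q)"
    proof -
      have "(\<integral>w. indicator A (W w) \<partial>Q) = (\<integral>w. indicator (W -` A \<inter> space Q) w \<partial>Q :: real)"
        by (intro Bochner_Integration.integral_cong) (auto simp: indicator_def)
      then show ?thesis by (simp add: Q.emeasure_eq_measure)
    qed
    also have "\<dots> = ennreal (\<integral>w. measure (K (U w)) A \<partial>Q)" by (simp add: eq)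
    also have "\<dots> = (\<integral>\<^sup>+w. ennreal (measure (K (U w)) A) \<partial>Q)"
    proof (intro nn_integral_eq_integral[symmetric] Q.integrable_const_bound[where B=1])
      show "AE w in Q. norm (measure (K (U w)) A) \<le> 1"
        using KUs(1) by (intro AE_I2) (simp add: prob_space.prob_le_1)
    qed auto
    also have "\<dots> = (\<integral>\<^sup>+w. emeasure (K (U w)) A \<partial>Q)"
      using KUs(1) by (intro nn_integral_cong)
        (simp add: finite_measure.emeasure_eq_measure prob_space.finite_measure)
    also have "\<dots> = emeasure (Q \<bind> (\<lambda>w. K (U w))) A"
      using KU' A by (intro emeasure_bind[symmetric]) (auto simp: Q.not_empty)
    finally show "emeasure (distr Q N W) A = emeasure (Q \<bind> (\<lambda>w. K (U w))) A" .
  qed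
  then have "(\<integral>w. f (W w) \<partial>Q) = (\<integral>y. f y \<partial>(Q \<bind> (\<lambda>w. K (U w))))"
    by (subst integral_distr[symmetric, of W Q N f]) auto
  also have "\<dots> = (\<integral>w. (\<integral>y. f y \<partial>K (U w)) \<partial>Q)"
    using KUs(1) KU' bounded
    by (intro integral_bind[where K=N and B'=1])
      (auto simp: Q.finite_measure_axioms prob_space.emeasure_space_1)
  finally show ?thesis .
qed

section \<open>The transition semigroup\<close>

context standard_process
begin

text \<open>
  The operators \<open>P\<^sub>t f (x) = E\<^sub>x f(X\<^sub>t)\<close>.
\<close>

abbreviation semigroup_op :: "real \<Rightarrow> ('e \<Rightarrow> real) \<Rightarrow> 'e \<Rightarrow> real" where
  "semigroup_op t f x \<equiv> \<integral>\<omega>. f (X t \<omega>) \<partial>P x"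

lemma sets_P: "sets (P x) = sets (F \<infinity>)" and prob_space_P: "prob_space (P x)"
  using measurable_space[OF kernel, of x] by (simp_all add: space_prob_algebra)

lemma space_P: "space (P x) = space (F \<infinity>)"
  using sets_P by (rule sets_eq_imp_space_eq)

lemma measurable_X:
  assumes "0 \<le> t"
  shows "X t \<in> F \<infinity> \<rightarrow>\<^sub>M borel"
proof -
  have "measurable (F (ennreal t)) borel \<subseteq> measurable (F \<infinity>) (borel :: 'e measure)"
    by (rule measurable_mono) (simp_all add: sets_F_mono space_F[of "ennreal t"])
  then show ?thesis using adapted[OF assms] by (rule subsetD)
qed

lemma measurable_X_P: "0 \<le> t \<Longrightarrow> X t \<in> P x \<rightarrow>\<^sub>M borel"
  using measurable_X[of t] by (simp add: measurable_cong_sets[OF sets_P refl])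

lemma measurable_X_joint: "(\<lambda>(t, \<omega>). X (max 0 t) \<omega>) \<in> borel \<Otimes>\<^sub>M F \<infinity> \<rightarrow>\<^sub>M borel"
  by (rule borel_measurable_right_continuous[OF measurable_X right_continuous_paths])

lemma kernel_X: "0 \<le> t \<Longrightarrow> (\<lambda>x. distr (P x) borel (X t)) \<in> borel \<rightarrow>\<^sub>M prob_algebra borel"
  using measurable_compose[OF kernel measurable_distr_prob_space[OF measurable_X]] .

lemma transition_eq:
  assumes t: "0 \<le> t" and A: "A \<in> sets borel"
  shows "transition X P t x A = measure (distr (P x) borel (X t)) A"
proof -
  have "X t -` A \<inter> space (P x) = {\<omega> \<in> space (P x). X t \<omega> \<in> A}" by blast
  then show ?thesis
    by (simp add: transition_def measure_distr[OF measurable_X_P[OF t] A])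
qed

lemma semigroup_eq:
  assumes t: "0 \<le> t" and f: "f \<in> borel_measurable borel"
  shows "semigroup_op t f x = (\<integral>y. f y \<partial>distr (P x) borel (X t))"
  by (rule integral_distr[symmetric, OF measurable_X_P[OF t] f])

text \<open>
  The strong Markov property at the constant time \<open>s\<close>, in integrated form.
\<close>

lemma Markov_set:
  assumes st: "0 \<le> s" "0 \<le> t" and A: "A \<in> sets borel" and D: "D \<in> sets (F (ennreal s))"
  shows "(\<integral>\<omega>. indicator D \<omega> * indicator A (X (s + t) \<omega>) \<partial>P x :: real)
       = (\<integral>\<omega>. indicator D \<omega> * transition X P t (X s \<omega>) A \<partial>P x)"
proof -
  let ?T = "\<lambda>\<omega>::'w. ennreal s"
  interpret P: prob_space "P x" by (rule prob_space_P)
  have T: "stopping_time F ?T" by (rule stopping_time_const)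
  have D': "D \<in> sets (pre_sigma ?T)"
  proof (rule sets_pre_sigmaI[OF T])
    show "{\<omega> \<in> D. ennreal s \<le> t} \<in> sets (F t)" for t
    proof (cases "ennreal s \<le> t")
      case True
      with D sets_F_mono[OF True] show ?thesis by (simp add: subset_iff)
    qed simp
  qed
  have sub: "subalgebra (P x) (pre_sigma ?T)"
  proof (unfold subalgebra_def, safe)
    fix B assume "B \<in> sets (pre_sigma ?T)"
    from sets_pre_sigmaD[OF T this, of \<infinity>] show "B \<in> sets (P x)" by (simp add: sets_P)
  qed (unfold space_pre_sigma space_P, simp_all)
  interpret fs: finite_measure_subalgebra "P x" "pre_sigma ?T"
    by standard (rule sub)
  have [measurable]: "X (s + t) \<in> P x \<rightarrow>\<^sub>M borel" using st by (intro measurable_X_P) simp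
  have int: "integrable (P x) (\<lambda>\<omega>. indicator A (X (s + t) \<omega>) :: real)"
    using A by (intro P.integrable_const_bound[where B=1]) auto
  have "(\<integral>\<omega>. indicator D \<omega> * indicator A (X (s + t) \<omega>) \<partial>P x :: real)
      = (\<integral>\<omega>\<in>D. indicator A (X (s + t) \<omega>) \<partial>P x)"
    by (simp add: set_lebesgue_integral_def)
  also have "\<dots> = (\<integral>\<omega>\<in>D. real_cond_exp (P x) (pre_sigma ?T) (\<lambda>\<omega>. indicator A (X (s + t) \<omega>)) \<omega> \<partial>P x)"
    by (rule fs.real_cond_exp_intA[OF int D'])
  also have "\<dots> = (\<integral>\<omega>. indicator D \<omega> * transition X P t (X s \<omega>) A \<partial>P x)"
    unfolding set_lebesgue_integral_def
  proof (rule integral_cong_AE)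
    have DP: "D \<in> sets (P x)" using D' sub unfolding subalgebra_def by blast
    then show "(\<lambda>\<omega>. indicat_real D \<omega> *\<^sub>R real_cond_exp (P x) (pre_sigma ?T)
        (\<lambda>\<omega>. indicator A (X (s + t) \<omega>)) \<omega>) \<in> borel_measurable (P x)"
      by measurable
    have "(\<lambda>\<omega>. measure (distr (P (X s \<omega>)) borel (X t)) A) \<in> borel_measurable (P x)"
      using measurable_compose[OF measurable_X_P[OF st(1)]
          measurable_compose[OF kernel_X[OF st(2)] measurable_measure_prob_algebra[OF A]]] by simp
    then show "(\<lambda>\<omega>. indicat_real D \<omega> * transition X P t (X s \<omega>) A) \<in> borel_measurable (P x)"
      using DP by (simp add: transition_eq[OF st(2) A])
    show "AE \<omega> in P x. indicat_real D \<omega> *\<^sub>R real_cond_exp (P x) (pre_sigma ?T)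
        (\<lambda>\<omega>. indicator A (X (s + t) \<omega>)) \<omega> = indicat_real D \<omega> * transition X P t (X s \<omega>) A"
      using strong_Markov[OF T st(2) A, of x] st by (auto elim: eventually_mono)
  qed
  finally show ?thesis .
qed

lemma semigroup_add:
  assumes st: "0 \<le> s" "0 \<le> t" and f: "f \<in> borel_measurable borel" "\<And>y. \<bar>f y\<bar> \<le> C"
  shows "semigroup_op s (semigroup_op t f) x = semigroup_op (s + t) f x"
proof -
  have "semigroup_op (s + t) f x = (\<integral>\<omega>. (\<integral>y. f y \<partial>distr (P (X s \<omega>)) borel (X t)) \<partial>P x)"
  proof (rule integral_eq_kernel[where N=borel and L=borel, OF prob_space_P])
    fix A :: "'e set" assume A: "A \<in> sets borel"
    have "(\<integral>\<omega>. indicator A (X (s + t) \<omega>) \<partial>P x)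
       = (\<integral>\<omega>. indicator (space (P x)) \<omega> * indicator A (X (s + t) \<omega>) \<partial>P x :: real)"
      by (intro Bochner_Integration.integral_cong) auto
    also have "\<dots> = (\<integral>\<omega>. indicator (space (P x)) \<omega> * transition X P t (X s \<omega>) A \<partial>P x)"
      by (intro Markov_set st A) (use sets.top[of "F (ennreal s)"] in \<open>simp add: space_F[of "ennreal s"] space_P\<close>)
    also have "\<dots> = (\<integral>\<omega>. measure (distr (P (X s \<omega>)) borel (X t)) A \<partial>P x)"
      by (intro Bochner_Integration.integral_cong) (auto simp: transition_eq st A)
    finally show "(\<integral>\<omega>. indicator A (X (s + t) \<omega>) \<partial>P x)
        = (\<integral>\<omega>. measure (distr (P (X s \<omega>)) borel (X t)) A \<partial>P x)" .
  qed (use st f in \<open>auto intro: measurable_X_P kernel_X\<close>)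
  then show ?thesis by (simp add: semigroup_eq[OF st(2) f(1)])
qed

end

section \<open>Strong continuity of the semigroup\<close>

text \<open>
  Shifting the window \<open>[0, 1]\<close> by \<open>r\<close> changes it on a set of measure at most \<open>2 r\<close>.
\<close>

lemma unit_average_shift:
  fixes q :: "real \<Rightarrow> real"
  assumes q: "q \<in> borel_measurable borel" "\<And>u. \<bar>q u\<bar> \<le> C" and r: "0 \<le> r"
  shows "\<bar>(LINT u:{0..1}|lborel. q (r + u)) - (LINT u:{0..1}|lborel. q u)\<bar> \<le> 2 * r * C"
proof -
  have C: "0 \<le> C" using q(2)[of 0] by linarith
  note [measurable] = q(1)
  have int: "integrable lborel (\<lambda>u. indicator {a..b} u * q u)" for a b
    by (rule integrableI_bounded_set[where A="{a..b}" and B=C])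
      (auto simp: indicator_def q C emeasure_lborel_Icc_eq)
  have "(LINT u:{0..1}|lborel. q (r + u)) = (\<integral>u. indicator {r..r+1} (r + 1 * u) * q (r + 1 * u) \<partial>lborel)"
    unfolding set_lebesgue_integral_def
    by (intro Bochner_Integration.integral_cong) (auto simp: indicator_def)
  also have "\<dots> = (\<integral>u. indicator {r..r+1} u * q u \<partial>lborel)"
    by (subst lborel_integral_real_affine[where c=1 and t=r]) auto
  finally have "(LINT u:{0..1}|lborel. q (r + u)) - (LINT u:{0..1}|lborel. q u)
     = (\<integral>u. (indicator {r..r+1} u - indicator {0..1} u) * q u \<partial>lborel)"
    by (simp add: set_lebesgue_integral_def left_diff_distrib int)
  also have "\<bar>\<dots>\<bar> \<le> (\<integral>u. C * indicator {0..r} u + C * indicator {1..1+r} u \<partial>lborel)"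
  proof (rule order_trans[OF integral_abs_bound], rule integral_mono)
    show "integrable lborel (\<lambda>u. \<bar>(indicator {r..r+1} u - indicator {0..1} u) * q u\<bar>)"
      by (intro integrable_abs) (simp add: left_diff_distrib int)
    show "integrable lborel (\<lambda>u. C * indicator {0..r} u + C * indicator {1..1+r} u :: real)"
      by (intro Bochner_Integration.integrable_add integrable_mult_right integrable_real_indicator)
        (simp_all add: emeasure_lborel_Icc_eq)
    show "\<bar>(indicator {r..r+1} u - indicator {0..1} u) * q u\<bar>
        \<le> C * indicator {0..r} u + C * indicator {1..1+r} u" for u
      using q(2)[of u] C r by (auto simp: indicator_def)
  qed
  also have "\<dots> = 2 * r * C" using r by simp
  finally show ?thesis .
qed

context standard_process
begin

text \<open>
  The average of \<open>P\<^sub>t f (x)\<close> over \<open>t \<in> [0, 1/(n + 1)]\<close>, in the rescaled variable \<open>u = (n + 1) t\<close>. Such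
  averages inherit continuity in \<open>x\<close> from the Feller property and, unlike \<open>f\<close> itself, are visibly
  almost invariant under \<open>P\<^sub>s\<close> for small \<open>s\<close> (\<open>semigroup_mean\<close>).
\<close>

abbreviation time_mean :: "nat \<Rightarrow> ('e \<Rightarrow> real) \<Rightarrow> 'e \<Rightarrow> real" where
  "time_mean n f x \<equiv> (LINT u:{0..1}|lborel. semigroup_op (max 0 u / real (Suc n)) f x)"

lemma integrable_semigroup:
  fixes f :: "'e \<Rightarrow> real"
  assumes "0 \<le> t" "f \<in> borel_measurable borel" "\<And>y. \<bar>f y\<bar> \<le> C"
  shows "integrable (P x) (\<lambda>\<omega>. f (X t \<omega>))"
proof -
  interpret P: prob_space "P x" by (rule prob_space_P)
  show ?thesis
    using measurable_compose[OF measurable_X_P[OF assms(1)] assms(2)] assms(3)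
    by (intro P.integrable_const_bound[where B=C]) auto
qed

lemma semigroup_bound:
  assumes "0 \<le> t" "f \<in> borel_measurable borel" "\<And>y. \<bar>f y\<bar> \<le> C"
  shows "\<bar>semigroup_op t f x\<bar> \<le> C"
proof -
  interpret P: prob_space "P x" by (rule prob_space_P)
  have "\<bar>semigroup_op t f x\<bar> \<le> (\<integral>\<omega>. \<bar>f (X t \<omega>)\<bar> \<partial>P x)" by (rule integral_abs_bound)
  also have "\<dots> \<le> (\<integral>\<omega>. C \<partial>P x)"
    using integrable_semigroup[OF assms, of x] assms(3)
    by (intro integral_mono) auto
  finally show ?thesis by (simp add: P.prob_space)
qed

lemma semigroup_mono:
  assumes t: "0 \<le> t" and f: "f \<in> borel_measurable borel" "\<And>y. \<bar>f y\<bar> \<le> C"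
    and g: "g \<in> borel_measurable borel" "\<And>y. \<bar>g y\<bar> \<le> D" and le: "\<And>y. f y \<le> g y"
  shows "semigroup_op t f x \<le> semigroup_op t g x"
  using integrable_semigroup[OF t f] integrable_semigroup[OF t g] le
  by (intro integral_mono)

lemma measurable_semigroup_joint:
  assumes f[measurable]: "f \<in> borel_measurable borel"
  shows "(\<lambda>(t, y). semigroup_op (max 0 t) f y) \<in> borel_measurable (borel \<Otimes>\<^sub>M borel)"
proof -
  have "(\<lambda>p. distr (P (snd p)) borel (X (max 0 (fst p)))) \<in> borel \<Otimes>\<^sub>M borel \<rightarrow>\<^sub>M prob_algebra borel"
  proof (rule measurable_distr_prob_space2[OF measurable_compose[OF measurable_snd kernel]])
    have "(\<lambda>q. (\<lambda>(t, \<omega>). X (max 0 t) \<omega>) (fst (fst q), snd q))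
      \<in> borel_measurable ((borel \<Otimes>\<^sub>M (borel :: 'e measure)) \<Otimes>\<^sub>M F \<infinity>)"
      by (intro measurable_compose[OF _ measurable_X_joint]) measurable
    then show "(\<lambda>(p, \<omega>). X (max 0 (fst p)) \<omega>)
      \<in> borel_measurable ((borel \<Otimes>\<^sub>M (borel :: 'e measure)) \<Otimes>\<^sub>M F \<infinity>)"
      by (simp add: case_prod_beta')
  qed
  from measurable_compose[OF measurable_prob_algebraD[OF this] integral_measurable_subprob_algebra[OF f]]
  show ?thesis
    by (simp add: integral_distr measurable_X_P case_prod_beta')
qed

lemma measurable_semigroup_time:
  assumes "f \<in> borel_measurable borel"
  shows "(\<lambda>t. semigroup_op (max 0 t) f y) \<in> borel_measurable borel"
  using measurable_compose[OF measurable_Pair2'[of y] measurable_semigroup_joint[OF assms]]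
  by (simp add: measurable_Pair)

lemma measurable_semigroup_mean:
  assumes f: "f \<in> borel_measurable borel"
  shows "(\<lambda>u. semigroup_op (max 0 u / real (Suc n)) f y) \<in> borel_measurable borel"
proof -
  have "(\<lambda>u. semigroup_op (max 0 (max 0 u / real (Suc n))) f y) \<in> borel_measurable borel"
    by (rule measurable_compose[OF _ measurable_semigroup_time[OF f]]) measurable
  moreover have "max 0 (max 0 u / real (Suc n)) = max 0 u / real (Suc n)" for u :: real
    by (simp del: of_nat_Suc)
  ultimately show ?thesis by simp
qed

lemma mean_integrand_bound:
  assumes f: "f \<in> borel_measurable borel" "\<And>y. \<bar>f y\<bar> \<le> C"
  shows "norm (indicat_real {0..1} u *\<^sub>R semigroup_op (max 0 u / real (Suc n)) f y) \<le> C * indicator {0..1} u"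
proof -
  have "\<bar>semigroup_op (max 0 u / real (Suc n)) f y\<bar> \<le> C"
    by (rule semigroup_bound[OF _ f]) (simp del: of_nat_Suc)
  from mult_left_mono[OF this, of "indicat_real {0..1} u"] show ?thesis
    by (simp add: abs_mult mult.commute del: of_nat_Suc)
qed

lemma integrable_mean:
  assumes f: "f \<in> borel_measurable borel" "\<And>y. \<bar>f y\<bar> \<le> C"
  shows "set_integrable lborel {0..1} (\<lambda>u. semigroup_op (max 0 u / real (Suc n)) f y)"
  unfolding set_integrable_def
proof (rule Bochner_Integration.integrable_bound)
  show "integrable lborel (\<lambda>u::real. C * indicator {0..1} u :: real)"
    by (intro integrable_mult_right integrable_real_indicator) (simp_all add: emeasure_lborel_Icc_eq)
  show "(\<lambda>u. indicat_real {0..1} u *\<^sub>R semigroup_op (max 0 u / real (Suc n)) f y) \<in> borel_measurable lborel"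
    using measurable_semigroup_mean[OF f(1), where n=n and y=y] by measurable
  have "0 \<le> C" using f(2)[of undefined] by linarith
  then show "AE u in lborel. norm (indicat_real {0..1} u *\<^sub>R semigroup_op (max 0 u / real (Suc n)) f y)
      \<le> norm (C * indicat_real {0..1} u)"
    using mean_integrand_bound[OF f] by (intro AE_I2) simp
qed

lemma mean_bound:
  assumes f: "f \<in> borel_measurable borel" "\<And>y. \<bar>f y\<bar> \<le> C"
  shows "\<bar>time_mean n f y\<bar> \<le> C"
proof -
  have "\<bar>time_mean n f y\<bar> \<le> (LINT u:{0..1}|lborel. \<bar>semigroup_op (max 0 u / real (Suc n)) f y\<bar>)"
    using set_integral_norm_bound[OF integrable_mean[OF f]] by simp
  also have "\<dots> \<le> (LINT u:{0..1::real}|lborel. C)"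
    by (intro set_integral_mono set_integrable_abs integrable_mean[OF f] semigroup_bound[OF _ f])
      (auto simp: set_integrable_def simp del: of_nat_Suc)
  finally show ?thesis by (simp add: set_lebesgue_integral_def)
qed

lemma mean_nonneg:
  assumes "\<And>y. 0 \<le> f y"
  shows "0 \<le> time_mean n f y"
  unfolding set_lebesgue_integral_def
  using assms by (intro Bochner_Integration.integral_nonneg) (auto simp: indicator_def intro!: Bochner_Integration.integral_nonneg)

text \<open>
  Only pointwise convergence: paths are right-continuous at \<open>0\<close> and start at \<open>x\<close>. Uniformity in \<open>x\<close> is
  what \<open>semigroup_deviation_local\<close> is about.
\<close>

lemma mean_tendsto:
  assumes f: "continuous_on UNIV f" "\<And>y. \<bar>f y\<bar> \<le> C"
  shows "(\<lambda>n. time_mean n f x) \<longlonglongrightarrow> f x"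
proof -
  interpret P: prob_space "P x" by (rule prob_space_P)
  have fm: "f \<in> borel_measurable borel" using f(1) by (rule borel_measurable_continuous_onI)
  have fX: "(\<lambda>\<omega>. f (X t \<omega>)) \<in> borel_measurable (P x)" if "0 \<le> t" for t
    by (rule measurable_compose[OF measurable_X_P[OF that] fm])
  have pointwise: "(\<lambda>n. semigroup_op (max 0 u / real (Suc n)) f x) \<longlonglongrightarrow> f x" for u
  proof -
    have "(\<lambda>n. semigroup_op (max 0 u / real (Suc n)) f x) \<longlonglongrightarrow> (\<integral>\<omega>. f (X 0 \<omega>) \<partial>P x)"
    proof (rule integral_dominated_convergence[where w="\<lambda>_. C"])
      show "AE \<omega> in P x. (\<lambda>n. f (X (max 0 u / real (Suc n)) \<omega>)) \<longlonglongrightarrow> f (X 0 \<omega>)"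
      proof (rule AE_I2)
        fix \<omega> assume \<omega>: "\<omega> \<in> space (P x)"
        have "((\<lambda>s. X s \<omega>) \<longlongrightarrow> X 0 \<omega>) (at_right 0)"
          using right_continuous_paths[of \<omega> 0] \<omega> by (simp add: space_P continuous_within)
        note right = this
        have "(\<lambda>n. X (max 0 u / real (Suc n)) \<omega>) \<longlonglongrightarrow> X 0 \<omega>"
        proof (cases "u \<le> 0")
          case False
          have "(\<lambda>n. max 0 u / real (Suc n)) \<longlonglongrightarrow> 0"
            using tendsto_mult[OF tendsto_const[of "max 0 u"] lim_1_over_n[THEN LIMSEQ_Suc]] by simp
          then have "filterlim (\<lambda>n. max 0 u / real (Suc n)) (at_right 0) sequentially"
            using False by (intro tendsto_imp_filterlim_at_right) (auto simp del: of_nat_Suc)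
          with right show ?thesis by (rule filterlim_compose)
        qed simp
        then show "(\<lambda>n. f (X (max 0 u / real (Suc n)) \<omega>)) \<longlonglongrightarrow> f (X 0 \<omega>)"
          by (rule continuous_on_tendsto_compose[OF f(1)]) auto
      qed
      show "AE \<omega> in P x. norm (f (X (max 0 u / real (Suc n)) \<omega>)) \<le> C" for n
        using f(2) by simp
    qed (auto intro!: fX simp del: of_nat_Suc)
    also have "(\<integral>\<omega>. f (X 0 \<omega>) \<partial>P x) = (\<integral>\<omega>. f x \<partial>P x)"
      using normal[of x] by (intro integral_cong_AE fX) auto
    finally show ?thesis by (simp add: P.prob_space)
  qed
  have "(\<lambda>n. time_mean n f x) \<longlonglongrightarrow> (LINT u:{0..1::real}|lborel. f x)"
    unfolding set_lebesgue_integral_def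
  proof (rule integral_dominated_convergence[where w="\<lambda>u. C * indicator {0..1} u"])
    show "(\<lambda>u. indicat_real {0..1} u *\<^sub>R semigroup_op (max 0 u / real (Suc n)) f x) \<in> borel_measurable lborel" for n
      using measurable_semigroup_mean[OF fm, where n=n and y=x] by measurable
    show "AE u in lborel. (\<lambda>n. indicat_real {0..1} u *\<^sub>R semigroup_op (max 0 u / real (Suc n)) f x) \<longlonglongrightarrow>
        indicat_real {0..1} u *\<^sub>R f x"
      by (intro AE_I2 tendsto_scaleR tendsto_const pointwise)
    show "AE u in lborel. norm (indicat_real {0..1} u *\<^sub>R semigroup_op (max 0 u / real (Suc n)) f x)
        \<le> C * indicator {0..1} u" for n
      by (intro AE_I2 mean_integrand_bound[OF fm f(2)])
  qed auto
  then show ?thesis by (simp add: set_lebesgue_integral_def)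
qed

lemma continuous_mean:
  assumes f: "f \<in> borel_measurable borel" "\<And>y. \<bar>f y\<bar> \<le> C"
    and Feller: "\<And>t. 0 < t \<Longrightarrow> continuous_on UNIV (semigroup_op t f)"
  shows "continuous_on UNIV (time_mean n f)"
proof (rule continuous_on_sequentiallyI)
  fix y :: "nat \<Rightarrow> 'e" and x assume y: "y \<longlonglongrightarrow> x"
  show "(\<lambda>k. time_mean n f (y k)) \<longlonglongrightarrow> time_mean n f x"
    unfolding set_lebesgue_integral_def
  proof (rule integral_dominated_convergence[where w="\<lambda>u. C * indicator {0..1} u"])
    have meas: "(\<lambda>u. indicat_real {0..1} u *\<^sub>R semigroup_op (max 0 u / real (Suc n)) f x) \<in> borel_measurable lborel" for x
      using measurable_semigroup_mean[OF f(1), where n=n and y=x] by measurable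
    show "(\<lambda>u. indicat_real {0..1} u *\<^sub>R semigroup_op (max 0 u / real (Suc n)) f x) \<in> borel_measurable lborel"
      and "(\<lambda>u. indicat_real {0..1} u *\<^sub>R semigroup_op (max 0 u / real (Suc n)) f (y k)) \<in> borel_measurable lborel" for k
      by (rule meas)+
    have "AE u in lborel. u \<noteq> (0::real)" by (rule AE_lborel_singleton)
    then show "AE u in lborel. (\<lambda>k. indicat_real {0..1} u *\<^sub>R semigroup_op (max 0 u / real (Suc n)) f (y k)) \<longlonglongrightarrow>
        indicat_real {0..1} u *\<^sub>R semigroup_op (max 0 u / real (Suc n)) f x"
    proof eventually_elim
      case (elim u)
      show ?case
      proof (cases "u \<in> {0..1}")
        case True
        with elim have "0 < max 0 u / real (Suc n)" by (simp del: of_nat_Suc)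
        from continuous_on_tendsto_compose[OF Feller[OF this] y] show ?thesis
          by (intro tendsto_scaleR tendsto_const) auto
      qed simp
    qed
    show "AE u in lborel. norm (indicat_real {0..1} u *\<^sub>R semigroup_op (max 0 u / real (Suc n)) f (y k))
        \<le> C * indicator {0..1} u" for k
      by (intro AE_I2 mean_integrand_bound[OF f])
    show "integrable lborel (\<lambda>u::real. C * indicator {0..1} u :: real)"
      by (intro integrable_mult_right integrable_real_indicator) (simp_all add: emeasure_lborel_Icc_eq)
  qed
qed

text \<open>
  By the semigroup law, applying \<open>P\<^sub>s\<close> to a time average shifts the averaging window by \<open>s\<close>.
\<close>

lemma semigroup_mean:
  assumes f: "f \<in> borel_measurable borel" "\<And>y. \<bar>f y\<bar> \<le> C" and s: "0 \<le> s"
  shows "\<bar>semigroup_op s (time_mean n f) x - time_mean n f x\<bar> \<le> 2 * s * real (Suc n) * C"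
proof -
  interpret Px: prob_space "P x" by (rule prob_space_P)
  interpret pair_sigma_finite lborel "P x" ..
  define q where "q u = semigroup_op (max 0 u / real (Suc n)) f x" for u
  have nn: "0 \<le> max 0 u / real (Suc n)" for u :: real by simp
  have C: "0 \<le> C" using f(2)[of undefined] by linarith
  let ?h = "\<lambda>(u::real, \<omega>). indicat_real {0..1} u *\<^sub>R semigroup_op (max 0 u / real (Suc n)) f (X s \<omega>)"
  have meas: "?h \<in> borel_measurable (lborel \<Otimes>\<^sub>M P x)"
  proof -
    have [measurable]: "X s \<in> P x \<rightarrow>\<^sub>M borel" by (rule measurable_X_P[OF s])
    have "(\<lambda>p. (\<lambda>(t, y). semigroup_op (max 0 t) f y) (max 0 (fst p) / real (Suc n), X s (snd p)))
      \<in> borel_measurable (lborel \<Otimes>\<^sub>M P x)"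
      by (rule measurable_compose[OF _ measurable_semigroup_joint[OF f(1)]]) measurable
    then have [measurable]: "(\<lambda>p. semigroup_op (max 0 (fst p) / real (Suc n)) f (X s (snd p)))
      \<in> borel_measurable (lborel \<Otimes>\<^sub>M P x)"
      using nn by (simp add: max_def[of 0 "max 0 _ / _"])
    show ?thesis unfolding case_prod_beta' by measurable
  qed
  have "integrable (lborel \<Otimes>\<^sub>M P x) ?h"
  proof (rule integrableI_bounded_set[where A="{0..1} \<times> space (P x)" and B=C])
    show "emeasure (lborel \<Otimes>\<^sub>M P x) ({0..1::real} \<times> space (P x)) < \<infinity>"
      by (subst sigma_finite_measure.emeasure_pair_measure_Times[OF Px.sigma_finite_measure_axioms,
            where A="{0..1::real}" and B="space (P x)" and N=lborel])
        (simp_all add: Px.emeasure_space_1 emeasure_lborel_Icc_eq)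
    show "AE p in lborel \<Otimes>\<^sub>M P x. p \<in> {0..1} \<times> space (P x) \<longrightarrow> norm (?h p) \<le> C"
    proof (intro AE_I2 impI)
      fix p :: "real \<times> 'w" assume "p \<in> {0..1} \<times> space (P x)"
      then have p: "indicat_real {0..1} (fst p) = 1" by auto
      from mean_integrand_bound[OF f, where u="fst p" and y="X s (snd p)" and n=n]
      show "norm (?h p) \<le> C" unfolding case_prod_beta' p by simp
    qed
    show "AE p in lborel \<Otimes>\<^sub>M P x. p \<notin> {0..1} \<times> space (P x) \<longrightarrow> ?h p = 0"
      by (intro AE_I2) (auto simp: indicator_def space_pair_measure)
  qed (use meas in auto)
  from Fubini_integral[OF this] have "semigroup_op s (time_mean n f) x
      = (\<integral>u. (\<integral>\<omega>. indicat_real {0..1} u *\<^sub>R semigroup_op (max 0 u / real (Suc n)) f (X s \<omega>) \<partial>P x) \<partial>lborel)"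
    by (simp add: set_lebesgue_integral_def)
  also have "\<dots> = (LINT u:{0..1}|lborel. q (s * real (Suc n) + u))"
    unfolding set_lebesgue_integral_def
  proof (intro Bochner_Integration.integral_cong refl)
    fix u :: real
    have "semigroup_op s (semigroup_op (u / real (Suc n)) f) x = q (s * real (Suc n) + u)" if "0 \<le> u"
    proof -
      have "s + u / real (Suc n) = max 0 (s * real (Suc n) + u) / real (Suc n)"
        using that s by (simp add: add_divide_distrib del: of_nat_Suc)
      then show ?thesis
        using semigroup_add[OF s _ f, of "u / real (Suc n)"] that by (simp add: q_def)
    qed
    then show "(\<integral>\<omega>. indicat_real {0..1} u *\<^sub>R semigroup_op (max 0 u / real (Suc n)) f (X s \<omega>) \<partial>P x)
      = indicat_real {0..1} u *\<^sub>R q (s * real (Suc n) + u)"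
      by (auto simp: indicator_def max_def)
  qed
  finally have "\<bar>semigroup_op s (time_mean n f) x - time_mean n f x\<bar>
     = \<bar>(LINT u:{0..1}|lborel. q (s * real (Suc n) + u)) - (LINT u:{0..1}|lborel. q u)\<bar>"
    by (simp add: q_def)
  also have "\<dots> \<le> 2 * (s * real (Suc n)) * C"
    using measurable_semigroup_mean[OF f(1)] semigroup_bound[OF nn f] s
    by (intro unit_average_shift) (auto simp: q_def)
  finally show ?thesis by (simp add: mult.assoc)
qed

text \<open>
  Put \<open>\<phi>(z) = \<bar>f(z) - f(x)\<bar>\<close>. The aim is to dominate \<open>\<phi>\<close>, up to \<open>\<epsilon>\<close>, by a multiple of a function
  \<open>\<psi>\<close> that is small at \<open>x\<close> and almost invariant under \<open>P\<^sub>s\<close>. A single time average of \<open>\<phi>\<close> need not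
  do, because it converges to \<open>\<phi>\<close> only pointwise. However, on the compact set \<open>K = {\<phi> \<ge> \<epsilon>}\<close> every
  point has some average above \<open>\<epsilon>/2\<close>, so finitely many of them suffice, and \<open>\<psi>\<close> is their sum. The
  averages are chosen in advance with values at \<open>x\<close> below \<open>\<eta>/2, \<eta>/4, \<dots>\<close>; hence \<open>\<psi>(x) < \<eta>\<close>
  however many of them are needed. By continuity \<open>\<psi> < \<eta>\<close> near \<open>x\<close>, which bounds \<open>P\<^sub>s \<psi>\<close> and thus \<open>P\<^sub>s \<phi>\<close>
  there.
\<close>

lemma semigroup_deviation_local:
  fixes f :: "'e \<Rightarrow> real"
  assumes compact: "compact (UNIV :: 'e set)"
    and Feller: "\<And>f t. continuous_on UNIV f \<Longrightarrow> 0 < t \<Longrightarrow> continuous_on UNIV (semigroup_op t f)"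
    and f: "continuous_on UNIV f" and e: "0 < e"
  shows "\<exists>N d. open N \<and> x \<in> N \<and> 0 < d \<and>
    (\<forall>y\<in>N. \<forall>s. 0 \<le> s \<longrightarrow> s \<le> d \<longrightarrow> semigroup_op s (\<lambda>z. \<bar>f z - f x\<bar>) y \<le> e)"
proof -
  define \<phi> where "\<phi> z = \<bar>f z - f x\<bar>" for z
  have \<phi>_cont: "continuous_on UNIV \<phi>"
    unfolding \<phi>_def by (intro continuous_intros f)
  have \<phi>_meas: "\<phi> \<in> borel_measurable borel"
    using \<phi>_cont by (rule borel_measurable_continuous_onI)
  have \<phi>_nonneg: "0 \<le> \<phi> z" for z by (simp add: \<phi>_def)
  have "bounded (range \<phi>)"
    using compact_continuous_image[OF \<phi>_cont compact] by (rule compact_imp_bounded)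
  then obtain C where C: "0 < C" "\<And>z. \<bar>\<phi> z\<bar> \<le> C"
    unfolding bounded_pos by auto
  define \<epsilon> where "\<epsilon> = e / 2"
  \<comment> \<open>so that \<open>2 C / \<epsilon> \<cdot> 2 \<eta> = \<epsilon>\<close> in the final estimate\<close>
  define \<eta> where "\<eta> = \<epsilon>\<^sup>2 / (4 * C)"
  have \<epsilon>: "0 < \<epsilon>" and \<eta>: "0 < \<eta>" using e C by (auto simp: \<epsilon>_def \<eta>_def)
  have lim: "(\<lambda>n. time_mean n \<phi> z) \<longlonglongrightarrow> \<phi> z" for z
    by (rule mean_tendsto[OF \<phi>_cont C(2)])
  have "\<exists>n\<ge>k. time_mean n \<phi> x < \<eta> * (1 / 2) ^ Suc k" for k
  proof -
    have "\<phi> x < \<eta> * (1 / 2) ^ Suc k" using \<eta> by (simp add: \<phi>_def)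
    with lim[of x] have "\<forall>\<^sub>F n in sequentially. time_mean n \<phi> x < \<eta> * (1 / 2) ^ Suc k"
      by (rule order_tendstoD)
    then obtain m where "\<forall>n\<ge>m. time_mean n \<phi> x < \<eta> * (1 / 2) ^ Suc k"
      unfolding eventually_sequentially ..
    then show ?thesis by (intro exI[of _ "max m k"]) auto
  qed
  then obtain n where n: "\<And>k. k \<le> n k" "\<And>k. time_mean (n k) \<phi> x < \<eta> * (1 / 2) ^ Suc k" by metis
  have cont: "continuous_on UNIV (time_mean k \<phi>)" for k
    by (rule continuous_mean[OF \<phi>_meas C(2) Feller[OF \<phi>_cont]])
  define K where "K = {z. \<epsilon> \<le> \<phi> z}"
  have "closed K"
    unfolding K_def using \<phi>_cont by (intro closed_Collect_le continuous_on_const)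
  then have "compact K" using compact_Int_closed[OF compact] by simp
  moreover have "K \<subseteq> (\<Union>k. {z. \<epsilon> / 2 < time_mean (n k) \<phi> z})"
  proof
    fix z assume "z \<in> K"
    then have "\<epsilon> / 2 < \<phi> z" using \<epsilon> by (simp add: K_def)
    moreover have "(\<lambda>k. time_mean (n k) \<phi> z) \<longlonglongrightarrow> \<phi> z"
      by (rule filterlim_compose[OF lim filterlim_at_top_mono[OF filterlim_ident always_eventually]])
        (simp add: n(1))
    ultimately have "\<forall>\<^sub>F k in sequentially. \<epsilon> / 2 < time_mean (n k) \<phi> z"
      by (intro order_tendstoD)
    then show "z \<in> (\<Union>k. {z. \<epsilon> / 2 < time_mean (n k) \<phi> z})"
      by (auto dest: eventually_happens)
  qed
  moreover have "open {z. \<epsilon> / 2 < time_mean (n k) \<phi> z}" for k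
    using cont by (intro open_Collect_less continuous_on_const)
  ultimately obtain I where I: "finite I" "K \<subseteq> (\<Union>k\<in>I. {z. \<epsilon> / 2 < time_mean (n k) \<phi> z})"
    by (meson compactE_image UNIV_I)
  define \<psi> where "\<psi> z = (\<Sum>k\<in>I. time_mean (n k) \<phi> z)" for z
  have \<psi>_cont: "continuous_on UNIV \<psi>"
    unfolding \<psi>_def by (intro continuous_on_sum cont)
  have \<psi>_meas: "\<psi> \<in> borel_measurable borel"
    using \<psi>_cont by (rule borel_measurable_continuous_onI)
  have mean_m: "time_mean k \<phi> \<in> borel_measurable borel" for k
    using cont by (rule borel_measurable_continuous_onI)
  have \<psi>_bound: "\<bar>\<psi> z\<bar> \<le> real (card I) * C" for z
    unfolding \<psi>_def using mean_bound[OF \<phi>_meas C(2)]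
    by (intro order_trans[OF sum_abs] sum_bounded_above)
  have \<psi>_nonneg: "0 \<le> \<psi> z" for z
    unfolding \<psi>_def by (intro sum_nonneg mean_nonneg \<phi>_nonneg)
  have \<psi>_x: "\<psi> x < \<eta>"
  proof -
    have sums: "(\<lambda>k. \<eta> * (1 / 2) ^ Suc k) sums (\<eta> * 1)"
      by (intro sums_mult power_half_series)
    have "\<psi> x \<le> (\<Sum>k\<in>insert 0 I. time_mean (n k) \<phi> x)"
      unfolding \<psi>_def using I(1) by (intro sum_mono2 mean_nonneg \<phi>_nonneg) auto
    also have "\<dots> < (\<Sum>k\<in>insert 0 I. \<eta> * (1 / 2) ^ Suc k)"
      by (intro sum_strict_mono n(2)) (use I(1) in auto)
    also have "\<dots> \<le> (\<Sum>k. \<eta> * (1 / 2) ^ Suc k)"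
      by (intro sum_le_suminf sums_summable[OF sums]) (use I(1) \<eta> in auto)
    also have "\<dots> = \<eta>" using sums_unique[OF sums] by simp
    finally show ?thesis .
  qed
  have dominated: "\<phi> z \<le> \<epsilon> + 2 * C / \<epsilon> * \<psi> z" for z
  proof (cases "z \<in> K")
    case True
    then obtain k where k: "k \<in> I" "\<epsilon> / 2 < time_mean (n k) \<phi> z" using I(2) by auto
    have "time_mean (n k) \<phi> z \<le> \<psi> z"
      unfolding \<psi>_def using I(1) k(1) by (intro member_le_sum mean_nonneg \<phi>_nonneg) auto
    with k(2) have "2 * C / \<epsilon> * (\<epsilon> / 2) \<le> 2 * C / \<epsilon> * \<psi> z"
      using C \<epsilon> by (intro mult_left_mono) auto
    then show ?thesis using C(2)[of z] \<epsilon> by simp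
  next
    case False
    then show ?thesis using C \<epsilon> \<psi>_nonneg[of z] by (simp add: K_def add_increasing2)
  qed
  define S where "S = (\<Sum>k\<in>I. 2 * real (Suc (n k)) * C)"
  have S: "0 \<le> S" unfolding S_def using C by (intro sum_nonneg) auto
  define N where "N = {z. \<psi> z < \<eta>}"
  \<comment> \<open>\<open>s S\<close> bounds the increase of \<open>\<psi>\<close> under \<open>P\<^sub>s\<close>; the summand \<open>1\<close> avoids a zero denominator\<close>
  define d where "d = \<eta> / (S + 1)"
  have "semigroup_op s \<phi> y \<le> e" if y: "y \<in> N" and s: "0 \<le> s" "s \<le> d" for y s
  proof -
    interpret P: prob_space "P y" by (rule prob_space_P)
    have int: "integrable (P y) (\<lambda>\<omega>. time_mean k \<phi> (X s \<omega>))" for k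
      by (rule integrable_semigroup[OF s(1) mean_m mean_bound[OF \<phi>_meas C(2)]])
    have "semigroup_op s \<psi> y - \<psi> y = (\<Sum>k\<in>I. semigroup_op s (time_mean (n k) \<phi>) y - time_mean (n k) \<phi> y)"
      unfolding \<psi>_def by (subst Bochner_Integration.integral_sum[OF int]) (simp add: sum_subtractf)
    also have "\<dots> \<le> (\<Sum>k\<in>I. s * (2 * real (Suc (n k)) * C))"
    proof (rule sum_mono)
      fix k
      show "semigroup_op s (time_mean (n k) \<phi>) y - time_mean (n k) \<phi> y \<le> s * (2 * real (Suc (n k)) * C)"
      proof -
        have "2 * s * real (Suc (n k)) * C = s * (2 * real (Suc (n k)) * C)" by (simp only: ac_simps)
        then show ?thesis using semigroup_mean[OF \<phi>_meas C(2) s(1), where n="n k" and x=y] by linarith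
      qed
    qed
    also have "\<dots> = s * S" by (simp add: S_def sum_distrib_left)
    also have "\<dots> \<le> d * S" using s S by (intro mult_right_mono)
    also have "\<dots> \<le> \<eta>" using S \<eta> by (simp add: d_def field_simps)
    finally have "semigroup_op s \<psi> y \<le> 2 * \<eta>" using y by (simp add: N_def)
    have "semigroup_op s \<phi> y \<le> semigroup_op s (\<lambda>z. \<epsilon> + 2 * C / \<epsilon> * \<psi> z) y"
    proof (rule semigroup_mono[OF s(1) \<phi>_meas C(2) _ _ dominated])
      show "(\<lambda>z. \<epsilon> + 2 * C / \<epsilon> * \<psi> z) \<in> borel_measurable borel"
        using \<psi>_meas by measurable
      show "\<bar>\<epsilon> + 2 * C / \<epsilon> * \<psi> z\<bar> \<le> \<epsilon> + 2 * C / \<epsilon> * (real (card I) * C)" for z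
        using C \<epsilon> \<psi>_bound[of z] \<psi>_nonneg[of z]
        by (subst abs_of_nonneg) (auto intro!: add_left_mono mult_left_mono divide_right_mono)
    qed
    also have "\<dots> = \<epsilon> + 2 * C / \<epsilon> * semigroup_op s \<psi> y"
      using integrable_semigroup[OF s(1) \<psi>_meas \<psi>_bound] by (simp add: P.prob_space)
    also have "\<dots> \<le> \<epsilon> + 2 * C / \<epsilon> * (2 * \<eta>)"
      using \<open>semigroup_op s \<psi> y \<le> 2 * \<eta>\<close> C \<epsilon> by (intro add_left_mono mult_left_mono) auto
    also have "\<dots> = e"
      using C \<epsilon> by (simp add: \<eta>_def \<epsilon>_def power2_eq_square field_simps)
    finally show ?thesis .
  qed
  moreover have "open N"
    unfolding N_def using \<psi>_cont by (intro open_Collect_less continuous_on_const)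
  moreover have "x \<in> N" using \<psi>_x by (simp add: N_def)
  moreover have "0 < d" using \<eta> S by (simp add: d_def)
  ultimately show ?thesis unfolding \<phi>_def by blast
qed

text \<open>
  Strong continuity of the semigroup. Since
  \<open>\<bar>P\<^sub>s f (y) - f(y)\<bar> \<le> P\<^sub>s \<bar>f - f(x)\<bar> (y) + \<bar>f(x) - f(y)\<bar>\<close>, the preceding lemma gives a common bound
  for \<open>y\<close> near \<open>x\<close>, and finitely many such neighbourhoods cover the space.
\<close>

lemma semigroup_uniformly_continuous:
  fixes f :: "'e \<Rightarrow> real"
  assumes compact: "compact (UNIV :: 'e set)"
    and Feller: "\<And>f t. continuous_on UNIV f \<Longrightarrow> 0 < t \<Longrightarrow> continuous_on UNIV (semigroup_op t f)"
    and f: "continuous_on UNIV f" and e: "0 < e"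
  obtains d where "0 < d" "\<And>s x. 0 \<le> s \<Longrightarrow> s \<le> d \<Longrightarrow> \<bar>semigroup_op s f x - f x\<bar> \<le> e"
proof -
  have fm: "f \<in> borel_measurable borel" using f by (rule borel_measurable_continuous_onI)
  have "bounded (range f)"
    using compact_continuous_image[OF f compact] by (rule compact_imp_bounded)
  then obtain C where C: "\<And>z. \<bar>f z\<bar> \<le> C"
    unfolding bounded_iff by auto
  define good where "good x N d \<longleftrightarrow> open N \<and> x \<in> N \<and> 0 < d \<and>
    (\<forall>y\<in>N. \<forall>s. 0 \<le> s \<longrightarrow> s \<le> d \<longrightarrow> \<bar>semigroup_op s f y - f y\<bar> \<le> e)" for x N d
  have "\<exists>N d. good x N d" for x
  proof -
    obtain N d where N: "open N" "x \<in> N" "0 < d"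
      "\<And>y s. y \<in> N \<Longrightarrow> 0 \<le> s \<Longrightarrow> s \<le> d \<Longrightarrow> semigroup_op s (\<lambda>z. \<bar>f z - f x\<bar>) y \<le> e / 2"
      using semigroup_deviation_local[OF compact Feller f, of "e / 2" x] e by auto
    define N' where "N' = N \<inter> {y. \<bar>f y - f x\<bar> < e / 2}"
    have "open N'"
      unfolding N'_def using f N(1)
      by (intro open_Int open_Collect_less continuous_intros)
    moreover have "x \<in> N'" using N(2) e by (simp add: N'_def)
    moreover have "\<bar>semigroup_op s f y - f y\<bar> \<le> e" if y: "y \<in> N'" and s: "0 \<le> s" "s \<le> d" for y s
    proof -
      interpret P: prob_space "P y" by (rule prob_space_P)
      have "semigroup_op s f y - f x = (\<integral>\<omega>. f (X s \<omega>) - f x \<partial>P y)"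
        using integrable_semigroup[OF s(1) fm C] by (simp add: P.prob_space)
      then have "\<bar>semigroup_op s f y - f x\<bar> \<le> semigroup_op s (\<lambda>z. \<bar>f z - f x\<bar>) y"
        by (simp add: integral_abs_bound)
      also have "\<dots> \<le> e / 2" using N(4) y s by (simp add: N'_def)
      finally have "\<bar>semigroup_op s f y - f x\<bar> \<le> e / 2" .
      moreover have "\<bar>f y - f x\<bar> < e / 2" using y by (simp add: N'_def)
      ultimately show ?thesis by linarith
    qed
    ultimately show ?thesis using N(3) unfolding good_def by blast
  qed
  then obtain N d where good: "\<And>x. good x (N x) (d x)" by metis
  have N: "open (N x)" "x \<in> N x" "0 < d x"
    "y \<in> N x \<Longrightarrow> 0 \<le> s \<Longrightarrow> s \<le> d x \<Longrightarrow> \<bar>semigroup_op s f y - f y\<bar> \<le> e" for x y s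
    using good[of x] unfolding good_def by blast+
  have "UNIV \<subseteq> (\<Union>x\<in>UNIV. N x)" using N(2) by blast
  then obtain I where I: "finite I" "UNIV \<subseteq> (\<Union>x\<in>I. N x)"
    by (rule compactE_image[OF compact N(1)])
  define d' where "d' = Min (insert 1 (d ` I))"
  show ?thesis
  proof
    show "0 < d'" using I N(3) by (simp add: d'_def)
    fix s x assume s: "0 \<le> s" "s \<le> d'"
    obtain z where z: "z \<in> I" "x \<in> N z" using I by blast
    have "d' \<le> d z" using I z by (simp add: d'_def)
    then show "\<bar>semigroup_op s f x - f x\<bar> \<le> e" using N(4)[OF z(2) s(1)] s(2) by simp
  qed
qed

end

section \<open>Controlled laws and grid strategies\<close>

context standard_process
begin

lemma space_seq_filtration [simp]: "space (seq_filtration F n t) = space (seq_space F)"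
  by (simp add: seq_filtration_def)

lemma measurable_filtration_mono:
  assumes "s \<le> t"
  shows "(\<lambda>\<omega>. \<omega>) \<in> F t \<rightarrow>\<^sub>M F s"
proof (rule measurableI)
  show "\<omega> \<in> space (F s)" if "\<omega> \<in> space (F t)" for \<omega>
    using that space_F[of s] space_F[of t] by simp
  show "(\<lambda>\<omega>. \<omega>) -` A \<inter> space (F t) \<in> sets (F t)" if "A \<in> sets (F s)" for A
    using that sets_F_mono[OF assms] by auto
qed

lemma restrict_space_seq:
  "(\<lambda>w. restrict w {..n}) \<in> space (seq_space F) \<rightarrow> space (Pi\<^sub>M {..n} (\<lambda>_. F t))"
  using space_F[of t] by (intro Pi_I) (auto simp: space_PiM PiE_iff extensional_def)

lemma measurable_coordinate:
  assumes "i \<le> n" "s \<le> t"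
  shows "(\<lambda>w. w i) \<in> seq_filtration F n t \<rightarrow>\<^sub>M F s"
proof -
  have "(\<lambda>w. restrict w {..n}) \<in> seq_filtration F n t \<rightarrow>\<^sub>M Pi\<^sub>M {..n} (\<lambda>_. F t)"
    unfolding seq_filtration_def by (rule measurable_vimage_algebra1[OF restrict_space_seq])
  moreover have "(\<lambda>w. w i) \<in> Pi\<^sub>M {..n} (\<lambda>_. F t) \<rightarrow>\<^sub>M F t"
    using assms by (intro measurable_component_singleton) simp
  ultimately have "(\<lambda>w. restrict w {..n} i) \<in> seq_filtration F n t \<rightarrow>\<^sub>M F t"
    by (rule measurable_compose)
  then show ?thesis
    using measurable_compose[OF _ measurable_filtration_mono[OF assms(2)]] assms(1) by simp
qed

lemma sets_seq_filtration_subset: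
  assumes "\<And>i. i \<le> n \<Longrightarrow> (\<lambda>w. w i) \<in> N \<rightarrow>\<^sub>M F t" "space N = space (seq_space F)"
  shows "sets (seq_filtration F n t) \<subseteq> sets N"
  unfolding seq_filtration_def
  by (rule sets_image_in_sets) (use assms in \<open>auto intro!: measurable_restrict\<close>)

lemma sets_seq_filtration_mono:
  "n \<le> m \<Longrightarrow> s \<le> t \<Longrightarrow> sets (seq_filtration F n s) \<subseteq> sets (seq_filtration F m t)"
  by (rule sets_seq_filtration_subset) (auto intro: measurable_coordinate)

lemma sets_seq_filtration_space: "sets (seq_filtration F n t) \<subseteq> sets (seq_space F)"
proof (rule sets_seq_filtration_subset)
  fix i
  have "(\<lambda>w. w i) \<in> seq_space F \<rightarrow>\<^sub>M F \<infinity>"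
    by (rule measurable_component_singleton) simp
  then show "(\<lambda>w. w i) \<in> seq_space F \<rightarrow>\<^sub>M F t"
    by (rule measurable_compose[OF _ measurable_filtration_mono]) simp
qed simp

lemma filtration_seq: "filtration (space (seq_space F)) (seq_filtration F n)"
  by standard (auto dest: subsetD[OF sets_seq_filtration_mono[OF order_refl]])

text \<open>
  This transfers the time before the first impulse, which only depends on the first copy, to the law
  of the uncontrolled process.
\<close>

lemma sets_seq_filtration_0:
  assumes "D \<in> sets (seq_filtration F 0 t)"
  obtains B where "B \<in> sets (F t)" "D = {w \<in> space (seq_space F). w 0 \<in> B}"
proof -
  from assms[unfolded seq_filtration_def sets_vimage_algebra2[OF restrict_space_seq]]
  obtain C where C: "C \<in> sets (Pi\<^sub>M {..0::nat} (\<lambda>_. F t))"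
    and D: "D = (\<lambda>w. restrict w {..0}) -` C \<inter> space (seq_space F)" by blast
  define B where "B = (\<lambda>\<omega>. \<lambda>i\<in>{..0::nat}. \<omega>) -` C \<inter> space (F t)"
  show ?thesis
  proof
    have "(\<lambda>\<omega>. \<lambda>i\<in>{..0::nat}. \<omega>) \<in> F t \<rightarrow>\<^sub>M Pi\<^sub>M {..0::nat} (\<lambda>_. F t)"
      by (rule measurable_restrict) simp
    then show "B \<in> sets (F t)" unfolding B_def using C by (rule measurable_sets)
    have "(\<lambda>i\<in>{..0::nat}. w 0) = restrict w {..0}" for w :: "nat \<Rightarrow> 'w"
      by (auto simp: restrict_def)
    then show "D = {w \<in> space (seq_space F). w 0 \<in> B}"
      using space_F[of t] unfolding D B_def by (auto simp: space_PiM)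
  qed
qed

lemma measurable_transition:
  "0 \<le> t \<Longrightarrow> A \<in> sets borel \<Longrightarrow> (\<lambda>y. transition X P t y A) \<in> borel_measurable borel"
  using measurable_compose[OF kernel_X measurable_measure_prob_algebra] by (simp add: transition_eq)

lemma transition_le_1: "transition X P t y A \<le> 1" and transition_nonneg: "0 \<le> transition X P t y A"
proof -
  interpret P: prob_space "P y" by (rule prob_space_P)
  show "transition X P t y A \<le> 1" "0 \<le> transition X P t y A"
    by (simp_all add: transition_def)
qed

end

locale grid_controlled_process = standard_process F X \<theta> P
  for F :: "ennreal \<Rightarrow> 'w measure"
    and X :: "real \<Rightarrow> 'w \<Rightarrow> 'e::{metric_space, second_countable_topology}"
    and \<theta> :: "real \<Rightarrow> 'w \<Rightarrow> 'w"
    and P :: "'e \<Rightarrow> 'w measure" +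
  fixes V :: "('w, 'e) strategy" and h :: real and x :: 'e and Q :: "(nat \<Rightarrow> 'w) measure"
  assumes h: "0 < h"
    and V: "V \<in> grid_strategies F h"
    and law: "controlled_law F X P x V Q"
begin

abbreviation \<tau> :: "nat \<Rightarrow> (nat \<Rightarrow> 'w) \<Rightarrow> ennreal" where
  "\<tau> i \<equiv> imp_time V i"

abbreviation Y :: "real \<Rightarrow> (nat \<Rightarrow> 'w) \<Rightarrow> 'e" where
  "Y \<equiv> controlled X V"

sublocale Q: prob_space Q
  using law by (simp add: controlled_law_def)

lemma sets_Q: "sets Q = sets (seq_space F)"
  using law by (simp add: controlled_law_def)

lemma space_Q: "space Q = space (seq_space F)"
  using sets_Q by (rule sets_eq_imp_space_eq)

lemma space_Q_coordinate: "w \<in> space Q \<Longrightarrow> w i \<in> space (F \<infinity>)"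
  by (auto simp: space_Q space_PiM)

lemma stopping_time_\<tau>: "stopping_time (seq_filtration F i) (\<tau> i)"
  and \<tau>_le_Suc: "w \<in> space Q \<Longrightarrow> \<tau> i w \<le> \<tau> (Suc i) w"
  using V by (simp_all add: grid_strategies_def strategies_def space_Q)

lemma \<tau>_grid:
  assumes "w \<in> space Q"
  obtains "\<tau> i w = \<infinity>" | k where "\<tau> i w = ennreal (real k * h)"
  using V assms unfolding grid_strategies_def space_Q by blast

lemma \<tau>_mono: "w \<in> space Q \<Longrightarrow> i \<le> j \<Longrightarrow> \<tau> i w \<le> \<tau> j w"
  by (rule lift_Suc_mono_le[of "\<lambda>i. \<tau> i w"]) (rule \<tau>_le_Suc)

lemma measurable_\<tau> [measurable]: "\<tau> i \<in> borel_measurable Q"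
proof (rule measurable_stopping_time[OF stopping_time_\<tau>[of i]])
  show "sets (seq_filtration F i t) \<subseteq> sets Q" for t
    unfolding sets_Q by (rule sets_seq_filtration_space)
qed (simp add: space_Q)

lemma measurable_coordinate_Q [measurable]: "(\<lambda>w. w i) \<in> Q \<rightarrow>\<^sub>M F \<infinity>"
  unfolding measurable_cong_sets[OF sets_Q refl] by (rule measurable_component_singleton) simp

lemma measurable_X_random_time:
  assumes [measurable]: "S \<in> borel_measurable Q" and S: "\<And>w. 0 \<le> S w"
  shows "(\<lambda>w. X (S w) (w i)) \<in> Q \<rightarrow>\<^sub>M borel"
proof -
  have "(\<lambda>w. (\<lambda>(t, \<omega>). X (max 0 t) \<omega>) (S w, w i)) \<in> Q \<rightarrow>\<^sub>M borel"
    by (rule measurable_compose[OF _ measurable_X_joint]) measurable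
  then show ?thesis using S by (simp add: max_absorb2)
qed

lemma measurable_Y:
  assumes "0 \<le> t"
  shows "Y t \<in> Q \<rightarrow>\<^sub>M borel"
proof -
  define n where "n w = (if \<exists>j. ennreal t < \<tau> j w then LEAST j. ennreal t < \<tau> j w else 0)" for w
  have [measurable]: "n \<in> Q \<rightarrow>\<^sub>M count_space UNIV" unfolding n_def by measurable
  have "(\<lambda>w. (\<lambda>i w. X t (w i)) (n w) w) \<in> Q \<rightarrow>\<^sub>M borel"
    by (rule measurable_compose_countable) (use assms in \<open>auto intro: measurable_X_random_time\<close>)
  moreover have "Y t w = X t (w (n w))" for w
    by (simp add: controlled_def n_def)
  ultimately show ?thesis by (simp add: cong: measurable_cong)
qed

lemma Y_eq:
  assumes "ennreal t < \<tau> j w" "\<And>i. i < j \<Longrightarrow> \<tau> i w \<le> ennreal t"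
  shows "Y t w = X t (w j)"
proof -
  have "(LEAST j. ennreal t < \<tau> j w) = j"
    by (rule Least_equality) (use assms in \<open>auto simp: not_less[symmetric] intro: ccontr\<close>)
  with assms(1) show ?thesis by (auto simp: controlled_def)
qed

lemma Y_right_continuous:
  assumes w: "w \<in> space Q" and t: "0 \<le> t"
  shows "continuous (at_right t) (\<lambda>s. Y s w)"
proof -
  have right: "continuous (at_right t) (\<lambda>s. X s (w i))" for i
    using space_Q_coordinate[OF w] t by (rule right_continuous_paths)
  have eq: "continuous (at_right t) (\<lambda>s. Y s w)"
    if "Y t w = X t (w i)" "\<forall>\<^sub>F s in at_right t. Y s w = X s (w i)" for i
    using right[of i] that(2) unfolding continuous_within that(1) by (simp cong: tendsto_cong)
  show ?thesis
  proof (cases "\<exists>j. ennreal t < \<tau> j w")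
    case True
    define j where "j = (LEAST j. ennreal t < \<tau> j w)"
    have j: "ennreal t < \<tau> j w" unfolding j_def using True by (rule LeastI_ex)
    have before: "\<tau> i w \<le> ennreal s" if "i < j" "t \<le> s" for i s
      using not_less_Least[OF that(1)[unfolded j_def]] ennreal_leI[OF that(2)] by simp
    obtain b where b: "t < b" "\<And>s. s < b \<Longrightarrow> ennreal s < \<tau> j w"
    proof (cases "\<tau> j w")
      case (real b)
      with j t show ?thesis by (intro that[of b]) (auto simp: ennreal_less_iff ennreal_lessI)
    next
      case top
      then show ?thesis by (intro that[of "t + 1"]) auto
    qed
    have Yj: "Y s w = X s (w j)" if "t \<le> s" "s < b" for s
      using b(2)[OF that(2)] before[OF _ that(1)] by (rule Y_eq)
    show ?thesis
      using b(1) Yj by (intro eq[of j]) (auto simp: eventually_at_right_field)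
  next
    case False
    then have "\<not> ennreal s < \<tau> j w" if "t \<le> s" for s j
      using that t ennreal_leI[of t s] by (meson le_less_trans)
    then have "Y s w = X s (w 0)" if "t \<le> s" for s
      using that by (simp add: controlled_def)
    then show ?thesis
      by (intro eq[of 0]) (auto simp: eventually_at_filter)
  qed
qed

lemma measurable_Y_joint: "(\<lambda>(t, w). Y (max 0 t) w) \<in> borel \<Otimes>\<^sub>M Q \<rightarrow>\<^sub>M borel"
  by (rule borel_measurable_right_continuous[OF measurable_Y Y_right_continuous])

text \<open>
  At time \<open>kh\<close> the process uses copy \<open>i + 1\<close>, started by the impulse at time \<open>mh\<close>. Fixing \<open>m\<close> makes
  the time elapsed since that impulse deterministic, as required by the Markov property of the
  restarted copy.
\<close>

definition segment_after :: "nat \<Rightarrow> nat \<Rightarrow> nat \<Rightarrow> (nat \<Rightarrow> 'w) set" where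
  "segment_after k i m = {w \<in> space Q. m \<le> k \<and> \<tau> i w = ennreal (real m * h) \<and>
    ennreal (real k * h) < \<tau> (Suc i) w}"

definition segment_initial :: "nat \<Rightarrow> (nat \<Rightarrow> 'w) set" where
  "segment_initial k = {w \<in> space Q. ennreal (real k * h) < \<tau> 0 w}"

lemma Markov_initial:
  assumes r: "0 \<le> r" and A: "A \<in> sets borel"
  shows "(\<integral>w. indicator (segment_initial k) w * indicator A (X (real k * h + r) (w 0)) \<partial>Q :: real)
    = (\<integral>w. indicator (segment_initial k) w * transition X P r (X (real k * h) (w 0)) A \<partial>Q)"
proof -
  let ?s = "real k * h"
  have s: "0 \<le> ?s" and sr: "0 \<le> ?s + r" using h r by simp_all
  have "segment_initial k \<in> sets (seq_filtration F 0 (ennreal ?s))"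
    using stopping_timeD2[OF stopping_time_\<tau>[of 0]] by (simp add: segment_initial_def space_Q pred_def)
  then obtain B where B: "B \<in> sets (F (ennreal ?s))"
    and D: "segment_initial k = {w \<in> space (seq_space F). w 0 \<in> B}"
    by (rule sets_seq_filtration_0)
  have BI: "B \<in> sets (F \<infinity>)" using B sets_F_mono[of "ennreal ?s" \<infinity>] by auto
  have P: "distr Q (F \<infinity>) (\<lambda>w. w 0) = P x"
    using law by (simp add: controlled_law_def)
  note [measurable] = A BI measurable_X[OF s] measurable_X[OF sr] measurable_transition[OF r A]
  have ind: "indicator (segment_initial k) w = (indicator B (w 0) :: real)" if "w \<in> space Q" for w
    using that by (simp add: D space_Q indicator_def)
  have "(\<integral>w. indicator (segment_initial k) w * indicator A (X (?s + r) (w 0)) \<partial>Q)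
      = (\<integral>w. indicator B (w 0) * indicator A (X (?s + r) (w 0)) \<partial>Q :: real)"
    by (intro Bochner_Integration.integral_cong) (simp_all add: ind)
  also have "\<dots> = (\<integral>\<omega>. indicator B \<omega> * indicator A (X (?s + r) \<omega>) \<partial>P x)"
    unfolding P[symmetric] by (rule integral_distr[symmetric]) measurable
  also have "\<dots> = (\<integral>\<omega>. indicator B \<omega> * transition X P r (X ?s \<omega>) A \<partial>P x)"
    by (rule Markov_set[OF s r A B])
  also have "\<dots> = (\<integral>w. indicator B (w 0) * transition X P r (X ?s (w 0)) A \<partial>Q)"
    unfolding P[symmetric] by (rule integral_distr) measurable
  also have "\<dots> = (\<integral>w. indicator (segment_initial k) w * transition X P r (X ?s (w 0)) A \<partial>Q)"
    by (intro Bochner_Integration.integral_cong) (simp_all add: ind)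
  finally show ?thesis .
qed

text \<open>
  The event lies in the past of the random time \<open>\<tau>\<^sub>i + s\<close> with \<open>s = (k - m) h\<close>, because on it this time
  equals \<open>kh\<close>. So the Markov property of the restarted copy at \<open>\<tau>\<^sub>i + s\<close> may be integrated over it.
\<close>

lemma Markov_after:
  assumes r: "0 \<le> r" and A: "A \<in> sets borel"
  shows "(\<integral>w. indicator (segment_after k i m) w * indicator A (X (real k * h + r) (w (Suc i))) \<partial>Q :: real)
    = (\<integral>w. indicator (segment_after k i m) w * transition X P r (X (real k * h) (w (Suc i))) A \<partial>Q)"
proof (cases "m \<le> k")
  case True
  let ?D = "segment_after k i m"
  define s where "s = real (k - m) * h"
  have s: "0 \<le> s" and ms: "real m * h + s = real k * h"
    using h True by (simp_all add: s_def of_nat_diff algebra_simps)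
  \<comment> \<open>on the segment this random time is the deterministic time \<open>kh\<close>\<close>
  define T where "T w = \<tau> i w + ennreal s" for w
  interpret seq: filtration "space (seq_space F)" "seq_filtration F (Suc i)"
    by (rule filtration_seq)
  interpret seq_i: filtration "space (seq_space F)" "seq_filtration F i"
    by (rule filtration_seq)
  have T: "stopping_time (seq_filtration F (Suc i)) T"
  proof
    fix u :: ennreal
    have "{w \<in> space (seq_space F). T w \<le> u} = (if ennreal s \<le> u
        then {w \<in> space (seq_space F). \<tau> i w \<le> u - ennreal s} else {})"
    proof (cases "ennreal s \<le> u")
      case True
      then show ?thesis by (auto simp: T_def ennreal_le_minus_iff not_less)
    next
      case False
      have "ennreal s \<le> T w" for w by (simp add: T_def)
      with False show ?thesis by (auto dest: order_trans)
    qed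
    moreover have "{w \<in> space (seq_space F). \<tau> i w \<le> u - ennreal s} \<in> sets (seq_filtration F i (u - ennreal s))"
      using stopping_timeD[OF stopping_time_\<tau>[of i]] by (simp add: pred_def)
    moreover have "sets (seq_filtration F i (u - ennreal s)) \<subseteq> sets (seq_filtration F (Suc i) u)"
      by (rule sets_seq_filtration_mono) (simp_all add: diff_le_self_ennreal)
    ultimately show "Measurable.pred (seq_filtration F (Suc i) u) (\<lambda>w. T w \<le> u)"
      by (auto simp: pred_def)
  qed
  have T_D: "T w = ennreal (real k * h)" and \<tau>_D: "enn2real (\<tau> i w) + s = real k * h"
    if "w \<in> ?D" for w
    using that h s ms by (simp_all add: segment_after_def T_def flip: ennreal_plus)
  have D_k: "?D \<in> sets (seq_filtration F (Suc i) (ennreal (real k * h)))"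
  proof -
    have "{w \<in> space (seq_space F). \<tau> i w = ennreal (real m * h)} \<in> sets (seq_filtration F i (ennreal (real m * h)))"
      using seq_i.stopping_time_eq_const[OF stopping_time_\<tau>] by (simp add: pred_def)
    moreover have "sets (seq_filtration F i (ennreal (real m * h)))
        \<subseteq> sets (seq_filtration F (Suc i) (ennreal (real k * h)))"
      using True h by (intro sets_seq_filtration_mono ennreal_leI mult_right_mono) auto
    moreover have "{w \<in> space (seq_space F). ennreal (real k * h) < \<tau> (Suc i) w}
        \<in> sets (seq_filtration F (Suc i) (ennreal (real k * h)))"
      using stopping_timeD2[OF stopping_time_\<tau>[of "Suc i"]] by (simp add: pred_def)
    moreover have "?D = {w \<in> space (seq_space F). \<tau> i w = ennreal (real m * h)} \<inter>
        {w \<in> space (seq_space F). ennreal (real k * h) < \<tau> (Suc i) w}"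
      using True by (auto simp: segment_after_def space_Q)
    ultimately show ?thesis by auto
  qed
  have D_pre: "?D \<in> sets (seq.pre_sigma T)"
  proof (rule seq.sets_pre_sigmaI[OF T])
    fix u
    show "{w \<in> ?D. T w \<le> u} \<in> sets (seq_filtration F (Suc i) u)"
    proof (cases "ennreal (real k * h) \<le> u")
      case True
      then have "{w \<in> ?D. T w \<le> u} = ?D" by (auto simp: T_D)
      then show ?thesis using D_k sets_seq_filtration_mono[OF order_refl True] by auto
    next
      case False
      then have "{w \<in> ?D. T w \<le> u} = {}" by (auto simp: T_D)
      then show ?thesis by (simp only: sets.empty_sets)
    qed
  qed
  have sub: "subalgebra Q (seq.pre_sigma T)"
    unfolding subalgebra_def
  proof (intro conjI subsetI)
    fix B assume "B \<in> sets (seq.pre_sigma T)"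
    from seq.sets_pre_sigmaD[OF T this, of \<infinity>] show "B \<in> sets Q"
      using sets_seq_filtration_space by (auto simp: sets_Q)
  qed (unfold seq.space_pre_sigma space_Q, rule refl)
  interpret fs: finite_measure_subalgebra Q "seq.pre_sigma T"
    by standard (rule sub)
  let ?f = "\<lambda>w. indicat_real A (X (enn2real (\<tau> i w) + s + r) (w (Suc i)))"
  have D_Q: "?D \<in> sets Q" using D_pre sub unfolding subalgebra_def by blast
  have X1[measurable]: "(\<lambda>w. X (enn2real (\<tau> i w) + s + r) (w (Suc i))) \<in> Q \<rightarrow>\<^sub>M borel"
    and X2: "(\<lambda>w. X (enn2real (\<tau> i w) + s) (w (Suc i))) \<in> Q \<rightarrow>\<^sub>M borel"
    using s r by (auto intro!: measurable_X_random_time)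
  note X3[measurable] = measurable_compose[OF X2 measurable_transition[OF r A]]
  have int: "integrable Q ?f"
    using A by (intro Q.integrable_const_bound[where B=1]) auto
  have "(\<integral>w. indicator ?D w * indicator A (X (real k * h + r) (w (Suc i))) \<partial>Q) = (\<integral>w\<in>?D. ?f w \<partial>Q)"
    unfolding set_lebesgue_integral_def
    by (intro Bochner_Integration.integral_cong) (auto simp: \<tau>_D indicator_def)
  also have "\<dots> = (\<integral>w\<in>?D. real_cond_exp Q (seq.pre_sigma T) ?f w \<partial>Q)"
    by (rule fs.real_cond_exp_intA[OF int D_pre])
  also have "\<dots> = (\<integral>w\<in>?D. transition X P r (X (enn2real (\<tau> i w) + s) (w (Suc i))) A \<partial>Q)"
    unfolding set_lebesgue_integral_def
  proof (rule integral_cong_AE)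
    have "AE w in Q. \<tau> i w < \<infinity> \<longrightarrow> real_cond_exp Q (seq.pre_sigma T) ?f w
        = transition X P r (X (enn2real (\<tau> i w) + s) (w (Suc i))) A"
      using law s r A unfolding controlled_law_def T_def by blast
    then show "AE w in Q. indicat_real ?D w *\<^sub>R real_cond_exp Q (seq.pre_sigma T) ?f w
        = indicat_real ?D w *\<^sub>R transition X P r (X (enn2real (\<tau> i w) + s) (w (Suc i))) A"
      by (rule eventually_mono) (auto simp: indicator_def segment_after_def)
  qed (use D_Q in measurable)
  also have "\<dots> = (\<integral>w. indicator ?D w * transition X P r (X (real k * h) (w (Suc i))) A \<partial>Q)"
    unfolding set_lebesgue_integral_def
    by (intro Bochner_Integration.integral_cong) (auto simp: \<tau>_D indicator_def)
  finally show ?thesis .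
qed (simp add: segment_after_def)

end

section \<open>The Markov property of the controlled process between grid times\<close>

context grid_controlled_process
begin

lemma \<tau>_gap:
  assumes w: "w \<in> space Q" and gt: "ennreal (real k * h) < \<tau> i w" and r: "0 \<le> r" "r < h"
  shows "ennreal (real k * h + r) < \<tau> i w"
  using w
proof (cases rule: \<tau>_grid[of w i])
  case (2 l)
  with gt have "real k * h < real l * h" using h by (simp add: ennreal_less_iff)
  then have "Suc k \<le> l" using h by simp
  then have "real (Suc k) * h \<le> real l * h" using h by (intro mult_right_mono) auto
  then have "real k * h + r < real l * h" using r by (simp add: algebra_simps)
  then show ?thesis unfolding 2 using r h by (subst ennreal_less_iff) auto
qed simp

lemma Y_initial:
  assumes "w \<in> segment_initial k" "0 \<le> r" "r < h"
  shows "Y (real k * h + r) w = X (real k * h + r) (w 0)"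
  using assms \<tau>_gap by (intro Y_eq) (auto simp: segment_initial_def)

lemma Y_after:
  assumes w: "w \<in> segment_after k i m" and r: "0 \<le> r" "r < h"
  shows "Y (real k * h + r) w = X (real k * h + r) (w (Suc i))"
proof (rule Y_eq)
  show "ennreal (real k * h + r) < \<tau> (Suc i) w"
    using assms \<tau>_gap by (auto simp: segment_after_def)
  fix j assume "j < Suc i"
  then have "\<tau> j w \<le> \<tau> i w" using w by (intro \<tau>_mono) (auto simp: segment_after_def)
  also have "\<dots> = ennreal (real m * h)" using w by (simp add: segment_after_def)
  also have "\<dots> \<le> ennreal (real k * h + r)"
    using w r h by (intro ennreal_leI add_increasing2 mult_right_mono) (auto simp: segment_after_def)
  finally show "\<tau> j w \<le> ennreal (real k * h + r)" .
qed

text \<open>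
  The possible states of the strategy at time \<open>kh\<close>, enumerated by natural numbers so that countable
  additivity applies.
\<close>

definition segment :: "nat \<Rightarrow> nat \<Rightarrow> (nat \<Rightarrow> 'w) set" where
  "segment k p = (case p of 0 \<Rightarrow> segment_initial k
    | Suc q \<Rightarrow> segment_after k (fst (prod_decode q)) (snd (prod_decode q)))"

lemma sets_segment: "segment k p \<in> sets Q"
  unfolding segment_def segment_initial_def segment_after_def by (cases p) auto

lemma segment_after_disjoint:
  assumes "w \<in> segment_after k i m" "w \<in> segment_after k i' m'"
  shows "i = i' \<and> m = m'"
proof -
  have *: "\<not> a < a'" if "w \<in> segment_after k a b" "w \<in> segment_after k a' b'" for a b a' b'
  proof
    assume "a < a'"
    then have "\<tau> (Suc a) w \<le> \<tau> a' w" using that by (intro \<tau>_mono) (auto simp: segment_after_def)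
    also have "\<dots> = ennreal (real b' * h)" using that by (simp add: segment_after_def)
    also have "\<dots> \<le> ennreal (real k * h)"
      using that h by (intro ennreal_leI mult_right_mono) (auto simp: segment_after_def)
    finally show False using that by (simp add: segment_after_def not_le[symmetric])
  qed
  have "i = i'" using *[OF assms] *[OF assms(2,1)] by simp
  moreover have "real m * h = real m' * h"
    using assms h \<open>i = i'\<close> by (simp add: segment_after_def ennreal_inj)
  ultimately show ?thesis using h by simp
qed

lemma segment_initial_disjoint: "w \<in> segment_initial k \<Longrightarrow> w \<notin> segment_after k i m"
proof
  assume w: "w \<in> segment_initial k" "w \<in> segment_after k i m"
  have "ennreal (real k * h) < \<tau> 0 w" using w by (simp add: segment_initial_def)
  also have "\<dots> \<le> \<tau> i w" using w by (intro \<tau>_mono) (auto simp: segment_initial_def)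
  also have "\<dots> = ennreal (real m * h)" using w by (simp add: segment_after_def)
  also have "\<dots> \<le> ennreal (real k * h)"
    using w h by (intro ennreal_leI mult_right_mono) (auto simp: segment_after_def)
  finally show False by simp
qed

lemma segment_disjoint: "p \<noteq> p' \<Longrightarrow> segment k p \<inter> segment k p' = {}"
proof (cases p; cases p')
  fix q q' assume "p \<noteq> p'" "p = Suc q" "p' = Suc q'"
  then have "prod_decode q \<noteq> prod_decode q'" by (simp add: prod_decode_eq)
  then show ?thesis
    using segment_after_disjoint \<open>p = Suc q\<close> \<open>p' = Suc q'\<close>
    by (fastforce simp: segment_def prod_eq_iff)
qed (auto simp: segment_def dest: segment_initial_disjoint)

lemma segment_cover:
  assumes w: "w \<in> space Q" and ex: "\<exists>j. ennreal (real k * h) < \<tau> j w"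
  shows "w \<in> (\<Union>p. segment k p)"
proof -
  define j where "j = (LEAST j. ennreal (real k * h) < \<tau> j w)"
  have j: "ennreal (real k * h) < \<tau> j w" unfolding j_def using ex by (rule LeastI_ex)
  show ?thesis
  proof (cases j)
    case 0
    then have "w \<in> segment k 0" using w j by (simp add: segment_def segment_initial_def)
    then show ?thesis by blast
  next
    case (Suc i)
    have le: "\<tau> i w \<le> ennreal (real k * h)"
      using not_less_Least[of i "\<lambda>j. ennreal (real k * h) < \<tau> j w"] Suc by (simp add: j_def)
    with \<tau>_grid[OF w, of i] obtain m where m: "\<tau> i w = ennreal (real m * h)"
      by (metis ennreal_less_top infinity_ennreal_def leD)
    with le have "real m * h \<le> real k * h" using h by simp
    then have "m \<le> k" using h by simp
    then have "w \<in> segment k (Suc (prod_encode (i, m)))"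
      using w j m Suc by (simp add: segment_def segment_after_def)
    then show ?thesis by blast
  qed
qed

text \<open>
  Until the next grid time the process stays on the copy that it uses at time \<open>kh\<close>, and on each of
  the countably many segments that copy is Markov. The segments miss the paths with infinitely many
  impulses up to \<open>kh\<close>, hence the last hypothesis.
\<close>

lemma Markov_grid:
  fixes f :: "'e \<Rightarrow> real"
  assumes r: "0 \<le> r" "r < h" and f: "f \<in> borel_measurable borel" "\<And>y. \<bar>f y\<bar> \<le> C"
    and finite: "AE w in Q. \<exists>j. ennreal (real k * h) < \<tau> j w"
  shows "(\<integral>w. f (Y (real k * h + r) w) \<partial>Q) = (\<integral>w. semigroup_op r f (Y (real k * h) w) \<partial>Q)"
proof -
  let ?t = "real k * h"
  have t: "0 \<le> ?t" and tr: "0 \<le> ?t + r" using h r by simp_all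
  have "(\<integral>w. f (Y (?t + r) w) \<partial>Q) = (\<integral>w. (\<integral>y. f y \<partial>distr (P (Y ?t w)) borel (X r)) \<partial>Q)"
  proof (rule integral_eq_kernel[where N=borel and L=borel, OF Q.prob_space_axioms
        measurable_Y[OF tr] measurable_Y[OF t] kernel_X[OF r(1)] _ f])
    fix A :: "'e set" assume A: "A \<in> sets borel"
    let ?\<psi> = "\<lambda>w. indicat_real A (Y (?t + r) w)"
    let ?\<eta> = "\<lambda>w. transition X P r (Y ?t w) A"
    note [measurable] = A measurable_Y[OF tr] measurable_compose[OF measurable_Y[OF t] measurable_transition[OF r(1) A]]
    have segment: "(LINT w:segment k p|Q. ?\<psi> w) = (LINT w:segment k p|Q. ?\<eta> w)" for p
    proof (cases p)
      case 0
      have "(LINT w:segment_initial k|Q. ?\<psi> w)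
          = (\<integral>w. indicator (segment_initial k) w * indicator A (X (?t + r) (w 0)) \<partial>Q)"
        unfolding set_lebesgue_integral_def using Y_initial[OF _ r]
        by (intro Bochner_Integration.integral_cong) (auto simp: indicator_def)
      also have "\<dots> = (\<integral>w. indicator (segment_initial k) w * transition X P r (X ?t (w 0)) A \<partial>Q)"
        by (rule Markov_initial[OF r(1) A])
      also have "\<dots> = (LINT w:segment_initial k|Q. ?\<eta> w)"
        unfolding set_lebesgue_integral_def using Y_initial[of _ k 0] h
        by (intro Bochner_Integration.integral_cong) (auto simp: indicator_def)
      finally show ?thesis by (simp add: segment_def 0)
    next
      case (Suc q)
      obtain i m where q: "prod_decode q = (i, m)" by fastforce
      have "(LINT w:segment_after k i m|Q. ?\<psi> w)
          = (\<integral>w. indicator (segment_after k i m) w * indicator A (X (?t + r) (w (Suc i))) \<partial>Q)"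
        unfolding set_lebesgue_integral_def using Y_after[OF _ r]
        by (intro Bochner_Integration.integral_cong) (auto simp: indicator_def)
      also have "\<dots> = (\<integral>w. indicator (segment_after k i m) w * transition X P r (X ?t (w (Suc i))) A \<partial>Q)"
        by (rule Markov_after[OF r(1) A])
      also have "\<dots> = (LINT w:segment_after k i m|Q. ?\<eta> w)"
        unfolding set_lebesgue_integral_def using Y_after[of _ k i m 0] h
        by (intro Bochner_Integration.integral_cong) (auto simp: indicator_def)
      finally show ?thesis by (simp add: segment_def Suc q)
    qed
    have sum: "(\<integral>w. F w \<partial>Q) = (\<Sum>p. LINT w:segment k p|Q. F w)"
      if [measurable]: "F \<in> borel_measurable Q" and F: "\<And>w. \<bar>F w\<bar> \<le> 1" for F :: "(nat \<Rightarrow> 'w) \<Rightarrow> real"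
    proof -
      have int: "integrable Q F"
        by (rule Q.integrable_const_bound[where B=1]) (use F in auto)
      have un: "(\<Union>p. segment k p) \<in> sets Q" using sets_segment by auto
      have "(\<integral>w. F w \<partial>Q) = (LINT w:(\<Union>p. segment k p)|Q. F w)"
        unfolding set_lebesgue_integral_def
      proof (rule integral_cong_AE)
        show "AE w in Q. F w = indicat_real (\<Union>p. segment k p) w *\<^sub>R F w"
          using finite AE_space by eventually_elim (use segment_cover in simp)
      qed (use un in measurable)
      also have "\<dots> = (\<Sum>p. LINT w:segment k p|Q. F w)"
        by (rule lebesgue_integral_countable_add)
          (use sets_segment segment_disjoint integrable_mult_indicator[OF un int] in \<open>auto simp: set_integrable_def\<close>)
      finally show ?thesis .
    qed
    have "(\<integral>w. ?\<psi> w \<partial>Q) = (\<integral>w. ?\<eta> w \<partial>Q)"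
      by (subst (1 2) sum) (simp_all add: segment transition_nonneg transition_le_1)
    then show "(\<integral>w. ?\<psi> w \<partial>Q) = (\<integral>w. measure (distr (P (Y ?t w)) borel (X r)) A \<partial>Q)"
      by (simp add: transition_eq[OF r(1) A])
  qed
  then show ?thesis by (simp add: semigroup_eq[OF r(1) f(1)])
qed

end

section \<open>Discounting\<close>

lemma set_integral_Icc_add:
  fixes f :: "real \<Rightarrow> real"
  assumes f: "set_integrable lborel {a..c} f" and "a \<le> b" "b \<le> c"
  shows "(LINT s:{a..c}|lborel. f s) = (LINT s:{a..b}|lborel. f s) + (LINT s:{b..c}|lborel. f s)"
proof -
  have int: "set_integrable lborel {a<..<c} f"
    by (rule set_integrable_subset[OF f]) auto
  have "(LBINT s=ereal a..ereal b. f s) + (LBINT s=ereal b..ereal c. f s) = (LBINT s=ereal a..ereal c. f s)"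
    by (rule interval_integral_sum)
      (use assms int in \<open>simp add: min_absorb1 max_absorb2 interval_lebesgue_integrable_def einterval_eq\<close>)
  then show ?thesis
    using assms by (simp add: interval_integral_Icc)
qed

locale discount =
  fixes \<beta> :: "real \<Rightarrow> real"
  assumes \<beta>_pos: "0 \<le> t \<Longrightarrow> 0 < \<beta> t" and \<beta>_le_1: "0 \<le> t \<Longrightarrow> \<beta> t \<le> 1"
    and \<beta>_antimono: "0 \<le> s \<Longrightarrow> s \<le> t \<Longrightarrow> \<beta> t \<le> \<beta> s"
    and \<beta>_cont: "continuous_on {0..} \<beta>"
    and \<beta>_add: "0 \<le> s \<Longrightarrow> 0 \<le> t \<Longrightarrow> \<beta> t * \<beta> s \<le> \<beta> (t + s)"
    and \<beta>_diverges: "(\<integral>\<^sup>+ s\<in>{0..}. ennreal (\<beta> s) \<partial>lborel) = \<infinity>"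
begin

text \<open>
  The common denominator of the two averages.
\<close>

definition B :: "real \<Rightarrow> real" where
  "B T = (LINT s:{0..T}|lborel. \<beta> s)"

lemma set_integrable_\<beta>: "0 \<le> a \<Longrightarrow> set_integrable lborel {a..b} \<beta>"
  by (rule borel_integrable_atLeastAtMost')
    (rule continuous_on_subset[OF \<beta>_cont], auto)

lemma \<beta>_measurable: "(\<lambda>s. \<beta> (max 0 s)) \<in> borel_measurable borel"
proof (rule borel_measurable_continuous_onI)
  show "continuous_on UNIV (\<lambda>s. \<beta> (max 0 s))"
    by (rule continuous_on_compose2[OF \<beta>_cont]) (auto intro!: continuous_intros)
qed

lemma B_add:
  assumes "0 \<le> a" "a \<le> b"
  shows "B b = B a + (LINT s:{a..b}|lborel. \<beta> s)"
  unfolding B_def by (rule set_integral_Icc_add) (use assms set_integrable_\<beta> in auto)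

lemma integral_\<beta>_bounds:
  assumes "0 \<le> a" "a \<le> b"
  shows "\<beta> b * (b - a) \<le> (LINT s:{a..b}|lborel. \<beta> s)" "(LINT s:{a..b}|lborel. \<beta> s) \<le> \<beta> a * (b - a)"
proof -
  have const: "set_integrable lborel {a..b} (\<lambda>_. C)" "(LINT s:{a..b}|lborel. C) = C * (b - a)" for C :: real
    using assms by (simp_all add: set_integrable_def set_lebesgue_integral_def)
  show "\<beta> b * (b - a) \<le> (LINT s:{a..b}|lborel. \<beta> s)"
    unfolding const(2)[symmetric] using assms set_integrable_\<beta>[of a b]
    by (intro set_integral_mono const(1)) (auto intro: \<beta>_antimono)
  show "(LINT s:{a..b}|lborel. \<beta> s) \<le> \<beta> a * (b - a)"
    unfolding const(2)[symmetric] using assms set_integrable_\<beta>[of a b]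
    by (intro set_integral_mono const(1)) (auto intro: \<beta>_antimono)
qed

lemma B_0: "B 0 = 0"
  using integral_\<beta>_bounds[of 0 0] by (simp add: B_def)

lemma B_mono: "0 \<le> a \<Longrightarrow> a \<le> b \<Longrightarrow> B a \<le> B b"
  using B_add[of a b] integral_\<beta>_bounds(1)[of a b] \<beta>_pos[of b]
  by (smt (verit) mult_nonneg_nonneg)

lemma B_pos: "0 < T \<Longrightarrow> 0 < B T"
  using B_add[of 0 T] integral_\<beta>_bounds(1)[of 0 T] \<beta>_pos[of T] B_0
  by (smt (verit) mult_pos_pos)

lemma B_le_add:
  assumes "0 \<le> a" "a \<le> b"
  shows "B b \<le> B a + (b - a)"
proof -
  have "B b = B a + (LINT s:{a..b}|lborel. \<beta> s)" by (rule B_add[OF assms])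
  also have "\<dots> \<le> B a + \<beta> a * (b - a)"
    by (intro add_left_mono integral_\<beta>_bounds assms)
  also have "\<dots> \<le> B a + 1 * (b - a)"
    using assms \<beta>_le_1 by (intro add_left_mono mult_right_mono) auto
  finally show ?thesis by simp
qed

text \<open>
  If \<open>B\<close> were bounded, monotone convergence would bound the integral of \<open>\<beta>\<close> over \<open>[0, \<infinity>)\<close>.
\<close>

lemma B_at_top: "filterlim B at_top at_top"
  unfolding filterlim_at_top
proof
  fix K :: real
  have "\<exists>n. K < B (real n)"
  proof (rule ccontr)
    assume "\<not> ?thesis"
    then have le: "B (real n) \<le> K" for n by (simp add: not_less)
    define f where "f n s = ennreal (\<beta> (max 0 s)) * indicator {0..real n} s" for n and s :: real
    have f: "f n \<in> borel_measurable lborel" for n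
      using \<beta>_measurable unfolding f_def by measurable
    have "incseq f"
      by (rule incseq_SucI) (auto simp: f_def le_fun_def indicator_def)
    have SUP: "(SUP n. f n s) = ennreal (\<beta> s) * indicator {0..} s" for s
    proof (rule antisym)
      show "(SUP n. f n s) \<le> ennreal (\<beta> s) * indicator {0..} s"
        by (rule SUP_least) (auto simp: f_def indicator_def)
      have "s \<le> real (nat \<lceil>s\<rceil>)" by linarith
      then have "ennreal (\<beta> s) * indicator {0..} s \<le> f (nat \<lceil>s\<rceil>) s"
        by (auto simp: f_def indicator_def)
      also have "\<dots> \<le> (SUP n. f n s)" by (rule SUP_upper) simp
      finally show "ennreal (\<beta> s) * indicator {0..} s \<le> (SUP n. f n s)" .
    qed
    have int: "integral\<^sup>N lborel (f n) = ennreal (B (real n))" for n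
    proof -
      have "integral\<^sup>N lborel (f n) = (\<integral>\<^sup>+ s. ennreal (indicator {0..real n} s *\<^sub>R \<beta> s) \<partial>lborel)"
        by (intro nn_integral_cong) (auto simp: f_def indicator_def)
      also have "\<dots> = ennreal (B (real n))"
        unfolding B_def set_lebesgue_integral_def
        using set_integrable_\<beta>[of 0 "real n"]
        by (intro nn_integral_eq_integral)
          (auto simp: set_integrable_def indicator_def intro!: less_imp_le[OF \<beta>_pos])
      finally show ?thesis .
    qed
    have "\<infinity> = (SUP n. integral\<^sup>N lborel (f n))"
      using nn_integral_monotone_convergence_SUP[OF \<open>incseq f\<close> f] \<beta>_diverges SUP by simp
    also have "\<dots> \<le> ennreal K"
      unfolding int by (intro SUP_least ennreal_leI le)
    finally show False by (simp add: top_unique)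
  qed
  then obtain n where n: "K < B (real n)" ..
  have "K \<le> B T" if "real n \<le> T" for T
    using n B_mono[OF _ that] by simp
  then show "\<forall>\<^sub>F T in at_top. K \<le> B T"
    unfolding eventually_at_top_linorder by blast
qed

lemma phi_eq:
  assumes "0 < h" "0 \<le> t"
  shows "phi \<beta> h (t / h) = (LINT s:{t..t + h}|lborel. \<beta> s) / h"
proof -
  have "t / h * h = t" "(t / h + 1) * h = t + h" using assms by (simp_all add: field_simps)
  then show ?thesis by (simp add: phi_def)
qed

lemma phi_bounds:
  assumes h: "0 < h" and t: "0 \<le> t"
  shows "\<beta> h * \<beta> t \<le> phi \<beta> h (t / h)" "phi \<beta> h (t / h) \<le> \<beta> t" "0 < phi \<beta> h (t / h)"
proof -
  have "\<beta> h * \<beta> t * h \<le> \<beta> (t + h) * h"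
    using \<beta>_add[of h t] h t by (intro mult_right_mono) (auto simp: mult.commute)
  also have "\<dots> \<le> (LINT s:{t..t + h}|lborel. \<beta> s)"
    using integral_\<beta>_bounds(1)[of t "t + h"] h t by simp
  finally show 1: "\<beta> h * \<beta> t \<le> phi \<beta> h (t / h)"
    unfolding phi_eq[OF h t] using h by (simp add: pos_le_divide_eq)
  show "phi \<beta> h (t / h) \<le> \<beta> t"
    unfolding phi_eq[OF h t] using integral_\<beta>_bounds(2)[of t "t + h"] h t by (simp add: pos_divide_le_eq)
  show "0 < phi \<beta> h (t / h)"
    using 1 mult_pos_pos[OF \<beta>_pos[of h] \<beta>_pos[of t]] h t by simp
qed

lemma phi_step:
  assumes "0 < h"
  shows "phi \<beta> h (real i) * h = B (real (Suc i) * h) - B (real i * h)"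
proof -
  have "phi \<beta> h (real i) * h = (LINT s:{real i * h..real (Suc i) * h}|lborel. \<beta> s)"
    using assms by (simp add: phi_def add.commute)
  moreover have "real i * h \<le> real (Suc i) * h" using assms by (intro mult_right_mono) auto
  ultimately show ?thesis using B_add[of "real i * h" "real (Suc i) * h"] assms by simp
qed

lemma phi_nonneg: "0 < h \<Longrightarrow> 0 \<le> phi \<beta> h (real i)"
  using phi_bounds(3)[of h "real i * h"] by simp

lemma sum_phi:
  assumes "0 < h"
  shows "(\<Sum>i<n. phi \<beta> h (real i)) = B (real n * h) / h"
proof -
  have "(\<Sum>i<n. phi \<beta> h (real i)) * h = (\<Sum>i<n. B (real (Suc i) * h) - B (real i * h))"
    unfolding sum_distrib_right by (intro sum.cong refl phi_step assms)
  also have "\<dots> = B (real n * h)"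
    by (subst sum_lessThan_telescope) (simp add: B_0)
  finally show ?thesis using assms by (simp add: field_simps)
qed

end

section \<open>Expected running gain\<close>

text \<open>
  The decomposition \<open>Z = R + I\<close> gives \<open>Z\<^sup>+ + R\<^sup>- = R\<^sup>+ + I + Z\<^sup>-\<close>, an identity of nonnegative functions
  that can be integrated; \<open>Z\<^sup>- \<le> R\<^sup>-\<close> has a finite integral and may be subtracted.
\<close>

lemma ereal_expectation_add:
  fixes R :: "'a \<Rightarrow> real" and I :: "'a \<Rightarrow> ennreal"
  assumes R: "integrable Q R" and I[measurable]: "I \<in> borel_measurable Q"
  shows "ereal_expectation Q (\<lambda>w. ereal (R w) + enn2ereal (I w))
    = ereal (\<integral>w. R w \<partial>Q) + enn2ereal (\<integral>\<^sup>+w. I w \<partial>Q)"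
proof -
  note [measurable] = borel_measurable_integrable[OF R]
  define p where "p w = e2ennreal (ereal (R w) + enn2ereal (I w))" for w
  define n where "n w = e2ennreal (- (ereal (R w) + enn2ereal (I w)))" for w
  have pw: "p w + ennreal (- R w) = ennreal (R w) + I w + n w \<and> n w \<le> ennreal (- R w)" for w
  proof (cases "I w")
    case (real r)
    then have "enn2ereal (I w) = ereal r" by simp
    then have "p w = ennreal (R w + r)" "n w = ennreal (- (R w + r))"
      by (simp_all add: p_def n_def)
    then show ?thesis using real
      by (cases "R w \<ge> 0"; cases "R w + r \<ge> 0")
        (auto simp: ennreal_neg simp flip: ennreal_plus intro!: ennreal_leI)
  next
    case top
    then show ?thesis by (simp add: p_def n_def e2ennreal_neg)
  qed
  have meas: "p \<in> borel_measurable Q" "n \<in> borel_measurable Q"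
    unfolding p_def n_def by measurable
  define rp rn where "rp = (\<integral>\<^sup>+w. ennreal (R w) \<partial>Q)" and "rn = (\<integral>\<^sup>+w. ennreal (- R w) \<partial>Q)"
  have fin: "rp < \<infinity>" "rn < \<infinity>"
    using R unfolding real_integrable_def rp_def rn_def by (simp_all add: less_top)
  have intR: "(\<integral>w. R w \<partial>Q) = enn2real rp - enn2real rn"
    unfolding rp_def rn_def by (rule real_lebesgue_integral_def[OF R])
  have "integral\<^sup>N Q n \<le> rn"
    unfolding rn_def using pw by (intro nn_integral_mono) auto
  then have n_fin: "integral\<^sup>N Q n < \<infinity>" using fin(2) by simp
  have "(\<integral>\<^sup>+w. p w + ennreal (- R w) \<partial>Q) = (\<integral>\<^sup>+w. ennreal (R w) + I w + n w \<partial>Q)"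
    using pw by simp
  then have eq: "integral\<^sup>N Q p + rn = rp + integral\<^sup>N Q I + integral\<^sup>N Q n"
    using meas by (simp add: nn_integral_add rp_def rn_def)
  have "enn2ereal (integral\<^sup>N Q p) - enn2ereal (integral\<^sup>N Q n)
      = ereal (enn2real rp - enn2real rn) + enn2ereal (integral\<^sup>N Q I)"
  proof -
    obtain a where a: "0 \<le> a" "rp = ennreal a" using fin(1) by (cases rp) auto
    obtain b where b: "0 \<le> b" "rn = ennreal b" using fin(2) by (cases rn) auto
    obtain d where d: "0 \<le> d" "integral\<^sup>N Q n = ennreal d" using n_fin by (cases "integral\<^sup>N Q n") auto
    show ?thesis
    proof (cases "integral\<^sup>N Q I")
      case (real i)
      then have "integral\<^sup>N Q p \<noteq> \<top>" using eq a b d by (auto simp flip: ennreal_plus)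
      then obtain p' where p': "0 \<le> p'" "integral\<^sup>N Q p = ennreal p'" by (cases "integral\<^sup>N Q p") auto
      from eq have "p' + b = a + i + d"
        unfolding a b d real p' using a(1) b(1) d(1) real(1) p'(1) by (simp flip: ennreal_plus)
      then show ?thesis
        unfolding a b d real(2) p' using a(1) b(1) d(1) real(1) p'(1) by simp
    next
      case top
      then have "integral\<^sup>N Q p = \<top>" using eq b by (cases "integral\<^sup>N Q p") (auto simp flip: ennreal_plus)
      then show ?thesis unfolding d(2) top using d(1) by simp
    qed
  qed
  then show ?thesis
    unfolding ereal_expectation_def intR p_def n_def .
qed

lemma suminf_ereal_eq_enn2ereal:
  fixes f :: "nat \<Rightarrow> real"
  assumes "\<And>i. p i \<Longrightarrow> 0 \<le> f i"
  shows "(\<Sum>i. if p i then ereal (f i) else 0) = enn2ereal (\<Sum>i. if p i then ennreal (f i) else 0)"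
proof -
  have "(\<lambda>i. if p i then ereal (f i) else 0) = (\<lambda>i. enn2ereal (if p i then ennreal (f i) else 0))"
    using assms by (auto simp: fun_eq_iff zero_ennreal.rep_eq)
  then show ?thesis by (simp add: suminf_enn2ereal)
qed

lemma ennreal_suminf_ge:
  assumes "\<And>i. ennreal \<epsilon> \<le> f i" and "0 < \<epsilon>"
  shows "(\<Sum>i. f i) = (\<infinity>::ennreal)"
proof -
  have "\<infinity> = (\<integral>\<^sup>+i. ennreal \<epsilon> \<partial>count_space (UNIV :: nat set))"
    using assms(2) by (simp add: ennreal_mult_top)
  also have "\<dots> = (\<Sum>i::nat. ennreal \<epsilon>)" by (rule nn_integral_count_space_nat)
  also have "\<dots> \<le> (\<Sum>i. f i)" by (intro suminf_le assms summableI)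
  finally show ?thesis by (simp add: top_unique)
qed

locale grid_impulse_cost =
  grid_controlled_process F X \<theta> P V h x Q + discount \<beta>
  for F :: "ennreal \<Rightarrow> 'w measure"
    and X :: "real \<Rightarrow> 'w \<Rightarrow> 'e::{metric_space, second_countable_topology}"
    and \<theta> :: "real \<Rightarrow> 'w \<Rightarrow> 'w"
    and P :: "'e \<Rightarrow> 'w measure"
    and V :: "('w, 'e) strategy" and h :: real and x :: 'e and Q :: "(nat \<Rightarrow> 'w) measure"
    and \<beta> :: "real \<Rightarrow> real" +
  fixes g :: "'e \<Rightarrow> real" and c :: "'e \<Rightarrow> 'e \<Rightarrow> real" and M c0 \<delta> :: real
  assumes g_meas: "g \<in> borel_measurable borel" and g_le: "\<And>y. \<bar>g y\<bar> \<le> M"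
    and c_meas: "(\<lambda>(y, z). c y z) \<in> borel_measurable (borel \<Otimes>\<^sub>M borel)"
    and c0: "0 < c0" and c_ge: "\<And>y z. c0 \<le> c y z"
    and deviation: "\<And>s y. 0 \<le> s \<Longrightarrow> s \<le> h \<Longrightarrow> \<bar>semigroup_op s g y - g y\<bar> \<le> \<delta>"
begin

lemma M_nonneg: "0 \<le> M"
  using g_le[of x] by linarith

definition mean_gain :: "real \<Rightarrow> real" where
  "mean_gain s = (\<integral>w. g (Y s w) \<partial>Q)"

definition gain :: "real \<Rightarrow> real" where
  "gain T = (LINT s:{0..T}|lborel. \<beta> s * mean_gain s)"

lemma integrable_g_Y: "0 \<le> s \<Longrightarrow> integrable Q (\<lambda>w. g (Y s w))"
  using measurable_compose[OF measurable_Y g_meas] g_le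
  by (intro Q.integrable_const_bound[where B=M]) auto

lemma mean_gain_bound: "0 \<le> s \<Longrightarrow> \<bar>mean_gain s\<bar> \<le> M"
proof -
  assume s: "0 \<le> s"
  have "\<bar>mean_gain s\<bar> \<le> (\<integral>w. \<bar>g (Y s w)\<bar> \<partial>Q)"
    unfolding mean_gain_def by (rule integral_abs_bound)
  also have "\<dots> \<le> (\<integral>w. M \<partial>Q)"
    using integrable_g_Y[OF s] g_le by (intro integral_mono) auto
  finally show ?thesis by (simp add: Q.prob_space)
qed

lemma measurable_g_Y_joint:
  "(\<lambda>(s, w). g (Y (max 0 s) w)) \<in> borel_measurable (lborel \<Otimes>\<^sub>M Q)"
proof -
  have "(\<lambda>p. g ((\<lambda>(s, w). Y (max 0 s) w) p)) \<in> borel_measurable (borel \<Otimes>\<^sub>M Q)"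
    by (rule measurable_compose[OF measurable_Y_joint g_meas])
  moreover have "sets (lborel \<Otimes>\<^sub>M Q) = sets (borel \<Otimes>\<^sub>M Q)"
    by (rule sets_pair_measure_cong) simp_all
  ultimately show ?thesis
    by (simp add: case_prod_beta' cong: measurable_cong_sets)
qed

lemma measurable_mean_gain: "(\<lambda>s. mean_gain (max 0 s)) \<in> borel_measurable lborel"
  unfolding mean_gain_def
  by (rule Q.borel_measurable_lebesgue_integral) (rule measurable_g_Y_joint)

lemma set_integrable_gain:
  assumes "0 \<le> a"
  shows "set_integrable lborel {a..b} (\<lambda>s. \<beta> s * mean_gain s)"
  unfolding set_integrable_def
proof (rule Bochner_Integration.integrable_bound)
  show "integrable lborel (\<lambda>s::real. M * indicator {a..b} s :: real)"
    by (intro integrable_mult_right integrable_real_indicator) (simp_all add: emeasure_lborel_Icc_eq)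
  have "(\<lambda>s. indicator {a..b} s * (\<beta> (max 0 s) * mean_gain (max 0 s))) \<in> borel_measurable lborel"
    using \<beta>_measurable measurable_mean_gain by measurable
  moreover have "indicator {a..b} s * (\<beta> (max 0 s) * mean_gain (max 0 s))
      = indicator {a..b} s *\<^sub>R (\<beta> s * mean_gain s)" for s
    using assms by (auto simp: indicator_def max_absorb2)
  ultimately show "(\<lambda>s. indicat_real {a..b} s *\<^sub>R (\<beta> s * mean_gain s)) \<in> borel_measurable lborel"
    by simp
  have "\<bar>\<beta> s * mean_gain s\<bar> \<le> M" if "a \<le> s" for s
  proof -
    have "0 \<le> s" using assms that by simp
    then have "\<bar>\<beta> s\<bar> * \<bar>mean_gain s\<bar> \<le> 1 * M"
      using \<beta>_le_1[of s] less_imp_le[OF \<beta>_pos[of s]]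
      by (intro mult_mono mean_gain_bound) auto
    then show ?thesis by (simp add: abs_mult)
  qed
  then show "AE s in lborel. norm (indicat_real {a..b} s *\<^sub>R (\<beta> s * mean_gain s))
      \<le> norm (M * indicat_real {a..b} s)"
    using M_nonneg by (intro AE_I2) (auto simp: indicator_def)
qed

lemma gain_eq:
  assumes "0 \<le> T"
  shows "integrable Q (\<lambda>w. LINT s:{0..T}|lborel. \<beta> s * g (Y s w))" (is ?int)
    and "(\<integral>w. (LINT s:{0..T}|lborel. \<beta> s * g (Y s w)) \<partial>Q) = gain T" (is ?eq)
proof -
  interpret pair_sigma_finite lborel Q ..
  let ?h = "\<lambda>(s::real, w). indicat_real {0..T} s *\<^sub>R (\<beta> s * g (Y s w))"
  have "integrable (lborel \<Otimes>\<^sub>M Q) ?h"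
  proof (rule integrableI_bounded_set[where A="{0..T} \<times> space Q" and B=M])
    show "emeasure (lborel \<Otimes>\<^sub>M Q) ({0..T} \<times> space Q) < \<infinity>"
      using assms by (subst Q.emeasure_pair_measure_Times) (simp_all add: Q.emeasure_space_1 emeasure_lborel_Icc_eq)
    show "AE p in lborel \<Otimes>\<^sub>M Q. p \<in> {0..T} \<times> space Q \<longrightarrow> norm (?h p) \<le> M"
    proof (intro AE_I2 impI)
      fix p :: "real \<times> (nat \<Rightarrow> 'w)" assume p: "p \<in> {0..T} \<times> space Q"
      obtain s w where [simp]: "p = (s, w)" by fastforce
      have "\<bar>\<beta> s\<bar> * \<bar>g (Y s w)\<bar> \<le> 1 * M"
        using \<beta>_le_1[of s] less_imp_le[OF \<beta>_pos[of s]] p by (intro mult_mono g_le) auto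
      then show "norm (?h p) \<le> M" using p by (simp add: abs_mult)
    qed
    show "AE p in lborel \<Otimes>\<^sub>M Q. p \<notin> {0..T} \<times> space Q \<longrightarrow> ?h p = 0"
      by (intro AE_I2) (auto simp: indicator_def space_pair_measure)
    have "(\<lambda>p. indicator {0..T} (fst p) * (\<beta> (max 0 (fst p)) * g (Y (max 0 (fst p)) (snd p))))
        \<in> borel_measurable (lborel \<Otimes>\<^sub>M Q)"
      using \<beta>_measurable measurable_g_Y_joint[unfolded case_prod_beta'] by measurable
    moreover have "indicator {0..T} (fst p) * (\<beta> (max 0 (fst p)) * g (Y (max 0 (fst p)) (snd p))) = ?h p" for p
      by (auto simp: indicator_def max_absorb2 split: prod.splits)
    ultimately show "?h \<in> borel_measurable (lborel \<Otimes>\<^sub>M Q)" by simp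
  qed auto
  then have int: "integrable (lborel \<Otimes>\<^sub>M Q) (\<lambda>(s, w). indicat_real {0..T} s *\<^sub>R (\<beta> s * g (Y s w)))" .
  from integrable_snd[OF int] show ?int by (simp add: set_lebesgue_integral_def)
  from Fubini_integral[OF int] show ?eq
    by (simp add: set_lebesgue_integral_def gain_def mean_gain_def)
qed

lemma gain_add:
  "0 \<le> a \<Longrightarrow> a \<le> b \<Longrightarrow> gain b = gain a + (LINT s:{a..b}|lborel. \<beta> s * mean_gain s)"
  unfolding gain_def by (rule set_integral_Icc_add) (auto intro: set_integrable_gain)

text \<open>
  The strict inequality \<open>s < b\<close> matters: at \<open>b\<close> itself an impulse may occur.
\<close>

lemma gain_increment:
  assumes "0 \<le> a" "a \<le> b" and K: "\<And>s. a \<le> s \<Longrightarrow> s < b \<Longrightarrow> \<bar>mean_gain s - K\<bar> \<le> D"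
  shows "\<bar>gain b - gain a - K * (B b - B a)\<bar> \<le> D * (B b - B a)"
proof -
  have int: "set_integrable lborel {a..b} \<beta>" "set_integrable lborel {a..b} (\<lambda>s. \<beta> s * mean_gain s)"
    using assms by (auto intro: set_integrable_\<beta> set_integrable_gain)
  have diff: "set_integrable lborel {a..b} (\<lambda>s. \<beta> s * mean_gain s - K * \<beta> s)"
    using int by (intro set_integral_diff(1)) auto
  have "gain b - gain a - K * (B b - B a)
      = (LINT s:{a..b}|lborel. \<beta> s * mean_gain s - K * \<beta> s)"
    using int by (simp add: gain_add[OF assms(1,2)] B_add[OF assms(1,2)] set_integral_diff)
  also have "\<bar>\<dots>\<bar> \<le> (LINT s:{a..b}|lborel. \<bar>\<beta> s * mean_gain s - K * \<beta> s\<bar>)"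
    using set_integral_norm_bound[of lborel "{a..b}" "\<lambda>s. \<beta> s * mean_gain s - K * \<beta> s"] int by simp
  also have "\<dots> \<le> (LINT s:{a..b}|lborel. D * \<beta> s)"
    unfolding set_lebesgue_integral_def
  proof (rule integral_mono_AE)
    show "integrable lborel (\<lambda>s. indicat_real {a..b} s *\<^sub>R \<bar>\<beta> s * mean_gain s - K * \<beta> s\<bar>)"
      "integrable lborel (\<lambda>s. indicat_real {a..b} s *\<^sub>R (D * \<beta> s))"
      using set_integrable_abs[OF diff] set_integrable_mult_right[of D lborel "{a..b}" \<beta>] int(1)
      by (simp_all add: set_integrable_def)
    have "AE s in lborel. s \<noteq> b" by (rule AE_lborel_singleton)
    then show "AE s in lborel. indicat_real {a..b} s *\<^sub>R \<bar>\<beta> s * mean_gain s - K * \<beta> s\<bar>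
        \<le> indicat_real {a..b} s *\<^sub>R (D * \<beta> s)"
    proof eventually_elim
      case (elim s)
      show ?case
      proof (cases "s \<in> {a..b}")
        case True
        then have s: "0 \<le> s" "\<bar>mean_gain s - K\<bar> \<le> D" using elim assms by auto
        have "\<beta> s * mean_gain s - K * \<beta> s = (mean_gain s - K) * \<beta> s" by (simp add: algebra_simps)
        then have "\<bar>\<beta> s * mean_gain s - K * \<beta> s\<bar> = \<bar>mean_gain s - K\<bar> * \<beta> s"
          using \<beta>_pos[OF s(1)] by (simp add: abs_mult)
        also have "\<dots> \<le> D * \<beta> s"
          using s \<beta>_pos[OF s(1)] by (intro mult_right_mono) auto
        finally show ?thesis using True by simp
      qed simp
    qed
  qed
  also have "\<dots> = D * (B b - B a)"
    by (simp add: B_add[OF assms(1,2)])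
  finally show ?thesis .
qed

definition grid_gain :: "nat \<Rightarrow> real" where
  "grid_gain n = (\<Sum>i<n. phi \<beta> h (real i) * mean_gain (real i * h))"

lemma grid_gain_eq:
  shows "integrable Q (\<lambda>w. \<Sum>i<n. phi \<beta> h (real i) * g (Y (real i * h) w))"
    and "(\<integral>w. (\<Sum>i<n. phi \<beta> h (real i) * g (Y (real i * h) w)) \<partial>Q) = grid_gain n"
  using h integrable_g_Y by (simp_all add: grid_gain_def mean_gain_def)

lemma grid_gain_bound: "\<bar>h * grid_gain n\<bar> \<le> M * B (real n * h)"
proof -
  have "\<bar>grid_gain n\<bar> \<le> (\<Sum>i<n. \<bar>phi \<beta> h (real i) * mean_gain (real i * h)\<bar>)"
    unfolding grid_gain_def by (rule sum_abs)
  also have "\<dots> \<le> (\<Sum>i<n. phi \<beta> h (real i) * M)"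
    using h by (intro sum_mono) (auto simp: abs_mult phi_nonneg intro!: mult_left_mono mean_gain_bound)
  also have "\<dots> = M * B (real n * h) / h"
    unfolding sum_distrib_right[symmetric] sum_phi[OF h] by simp
  finally show ?thesis using h by (simp add: abs_mult field_simps)
qed

lemma mean_gain_deviation:
  assumes r: "0 \<le> r" "r < h" and finite: "AE w in Q. \<exists>j. ennreal (real k * h) < \<tau> j w"
  shows "\<bar>mean_gain (real k * h + r) - mean_gain (real k * h)\<bar> \<le> \<delta>"
proof -
  let ?t = "real k * h"
  have t: "0 \<le> ?t" using h by simp
  have f: "(\<lambda>y. semigroup_op r g y) \<in> borel_measurable borel"
    using measurable_compose[OF kernel_X[OF r(1), THEN measurable_prob_algebraD] integral_measurable_subprob_algebra[OF g_meas]]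
    by (simp add: semigroup_eq[OF r(1) g_meas])
  have int: "integrable Q (\<lambda>w. semigroup_op r g (Y ?t w))"
    using measurable_compose[OF measurable_Y[OF t] f] semigroup_bound[OF r(1) g_meas g_le]
    by (intro Q.integrable_const_bound[where B=M]) auto
  have "mean_gain (?t + r) - mean_gain ?t = (\<integral>w. semigroup_op r g (Y ?t w) - g (Y ?t w) \<partial>Q)"
    using Markov_grid[OF r g_meas g_le finite] int integrable_g_Y[OF t] by (simp add: mean_gain_def)
  also have "\<bar>\<dots>\<bar> \<le> (\<integral>w. \<bar>semigroup_op r g (Y ?t w) - g (Y ?t w)\<bar> \<partial>Q)"
    by (rule integral_abs_bound)
  also have "\<dots> \<le> (\<integral>w. \<delta> \<partial>Q)"
    using int integrable_g_Y[OF t] deviation r by (intro integral_mono) auto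
  finally show ?thesis by (simp add: Q.prob_space)
qed

text \<open>
  Each grid step contributes an error of at most \<open>\<delta>\<close> times the mass of the discount on it.
\<close>

lemma gain_grid_gain:
  assumes "\<And>k. k < n \<Longrightarrow> AE w in Q. \<exists>j. ennreal (real k * h) < \<tau> j w"
  shows "\<bar>gain (real n * h) - h * grid_gain n\<bar> \<le> \<delta> * B (real n * h)"
  using assms
proof (induction n)
  case 0
  have "gain 0 = 0" using gain_add[of 0 0] by (simp add: gain_def)
  then show ?case by (simp add: grid_gain_def B_0)
next
  case (Suc n)
  let ?t = "real n * h"
  have t: "0 \<le> ?t" and eq: "real (Suc n) * h = ?t + h" using h by (simp_all add: algebra_simps)
  have "\<bar>mean_gain s - mean_gain ?t\<bar> \<le> \<delta>" if "?t \<le> s" "s < ?t + h" for s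
    using mean_gain_deviation[of "s - ?t" n] Suc.prems[of n] that by simp
  from gain_increment[OF t _ this, of "?t + h"] h
  have "\<bar>gain (?t + h) - gain ?t - mean_gain ?t * (B (?t + h) - B ?t)\<bar> \<le> \<delta> * (B (?t + h) - B ?t)"
    by simp
  moreover have "h * grid_gain (Suc n) = h * grid_gain n + mean_gain ?t * (B (?t + h) - B ?t)"
  proof -
    have "h * grid_gain (Suc n) = h * grid_gain n + mean_gain ?t * (phi \<beta> h (real n) * h)"
      by (simp add: grid_gain_def algebra_simps)
    then show ?thesis unfolding phi_step[OF h] eq .
  qed
  moreover have "\<bar>gain ?t - h * grid_gain n\<bar> \<le> \<delta> * B ?t"
    using Suc by simp
  ultimately show ?case unfolding eq right_diff_distrib by linarith
qed

end

section \<open>Impulse costs and comparison of the averages\<close>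

context grid_impulse_cost
begin

definition impulse_sum :: "real \<Rightarrow> (nat \<Rightarrow> 'w) \<Rightarrow> ennreal" where
  "impulse_sum T w = (\<Sum>i. if \<tau> i w \<le> ennreal T
     then ennreal (\<beta> (enn2real (\<tau> i w)) * imp_cost c X V i w) else 0)"

definition grid_impulse_sum :: "nat \<Rightarrow> (nat \<Rightarrow> 'w) \<Rightarrow> ennreal" where
  "grid_impulse_sum n w = (\<Sum>i. if \<tau> i w \<le> ennreal (real n * h)
     then ennreal ((1 / h) * phi \<beta> h (enn2real (\<tau> i w) / h) * imp_cost c X V i w) else 0)"

lemma imp_cost_ge: "c0 \<le> imp_cost c X V i w"
  unfolding imp_cost_def by (rule c_ge)

lemma imp_cost_nonneg: "0 \<le> imp_cost c X V i w"
  using c0 imp_cost_ge[of i w] by linarith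

lemma measurable_imp_cost [measurable]: "imp_cost c X V i \<in> borel_measurable Q"
proof -
  have [measurable]: "(\<lambda>w. X (enn2real (\<tau> i w)) (w k)) \<in> Q \<rightarrow>\<^sub>M borel" for k
    by (rule measurable_X_random_time) auto
  have "(\<lambda>w. (\<lambda>(y, z). c y z) (X (enn2real (\<tau> i w)) (w i), X (enn2real (\<tau> i w)) (w (Suc i))))
      \<in> borel_measurable Q"
    by (rule measurable_compose[OF _ c_meas]) measurable
  then show ?thesis by (simp add: imp_cost_def[abs_def])
qed

lemma measurable_impulse_sum [measurable]: "impulse_sum T \<in> borel_measurable Q"
proof -
  have "(\<lambda>w. \<beta> (max 0 (enn2real (\<tau> i w)))) \<in> borel_measurable Q" for i
    by (rule measurable_compose[OF _ \<beta>_measurable]) measurable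
  then have [measurable]: "(\<lambda>w. \<beta> (enn2real (\<tau> i w))) \<in> borel_measurable Q" for i
    by (simp add: max_absorb2)
  show ?thesis unfolding impulse_sum_def[abs_def] by measurable
qed

lemma measurable_grid_impulse_sum [measurable]: "grid_impulse_sum n \<in> borel_measurable Q"
proof -
  have "mono (\<lambda>t. B (max 0 t))" by (intro monoI B_mono) auto
  then have B: "(\<lambda>t. B (max 0 t)) \<in> borel_measurable borel" by (rule borel_measurable_mono)
  have "(\<lambda>w. B (max 0 (enn2real (\<tau> i w) + h))) \<in> borel_measurable Q"
    "(\<lambda>w. B (max 0 (enn2real (\<tau> i w)))) \<in> borel_measurable Q" for i
    by (rule measurable_compose[OF _ B], measurable)+
  then have "(\<lambda>w. (B (max 0 (enn2real (\<tau> i w) + h)) - B (max 0 (enn2real (\<tau> i w)))) / h) \<in> borel_measurable Q" for i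
    by measurable
  moreover have "(B (max 0 (enn2real (\<tau> i w) + h)) - B (max 0 (enn2real (\<tau> i w)))) / h
      = phi \<beta> h (enn2real (\<tau> i w) / h)" for i w
    using h B_add[of "enn2real (\<tau> i w)" "enn2real (\<tau> i w) + h"]
    by (simp add: phi_eq max_absorb2)
  ultimately have [measurable]: "(\<lambda>w. phi \<beta> h (enn2real (\<tau> i w) / h)) \<in> borel_measurable Q" for i
    by simp
  show ?thesis unfolding grid_impulse_sum_def[abs_def] by measurable
qed

lemma grid_impulse_sum_le: "ennreal h * grid_impulse_sum n w \<le> impulse_sum (real n * h) w"
  unfolding grid_impulse_sum_def impulse_sum_def ennreal_suminf_cmult[symmetric]
proof (intro suminf_le summableI)
  fix i
  have "h * ((1 / h) * phi \<beta> h (enn2real (\<tau> i w) / h) * imp_cost c X V i w)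
      \<le> \<beta> (enn2real (\<tau> i w)) * imp_cost c X V i w"
    using h phi_bounds(2)[OF h, of "enn2real (\<tau> i w)"] imp_cost_nonneg by (simp add: mult_right_mono)
  then show "ennreal h * (if \<tau> i w \<le> ennreal (real n * h)
      then ennreal ((1 / h) * phi \<beta> h (enn2real (\<tau> i w) / h) * imp_cost c X V i w) else 0)
    \<le> (if \<tau> i w \<le> ennreal (real n * h) then ennreal (\<beta> (enn2real (\<tau> i w)) * imp_cost c X V i w) else 0)"
    using h by (auto simp: ennreal_mult'[symmetric] intro!: ennreal_leI)
qed

lemma impulse_sum_le: "ennreal (\<beta> h) * impulse_sum (real n * h) w \<le> ennreal h * grid_impulse_sum n w"
  unfolding grid_impulse_sum_def impulse_sum_def ennreal_suminf_cmult[symmetric]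
proof (intro suminf_le summableI)
  fix i
  have "\<beta> h * \<beta> (enn2real (\<tau> i w)) * imp_cost c X V i w \<le> phi \<beta> h (enn2real (\<tau> i w) / h) * imp_cost c X V i w"
    using phi_bounds(1)[OF h, of "enn2real (\<tau> i w)"] imp_cost_nonneg by (intro mult_right_mono) auto
  then have "\<beta> h * (\<beta> (enn2real (\<tau> i w)) * imp_cost c X V i w)
      \<le> h * ((1 / h) * phi \<beta> h (enn2real (\<tau> i w) / h) * imp_cost c X V i w)"
    using h by simp
  then show "ennreal (\<beta> h) * (if \<tau> i w \<le> ennreal (real n * h)
      then ennreal (\<beta> (enn2real (\<tau> i w)) * imp_cost c X V i w) else 0)
    \<le> ennreal h * (if \<tau> i w \<le> ennreal (real n * h)
      then ennreal ((1 / h) * phi \<beta> h (enn2real (\<tau> i w) / h) * imp_cost c X V i w) else 0)"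
    using h less_imp_le[OF \<beta>_pos[of h]] by (auto simp: ennreal_mult'[symmetric] intro!: ennreal_leI)
qed

definition total_impulse :: "real \<Rightarrow> ennreal" where
  "total_impulse T = (\<integral>\<^sup>+w. impulse_sum T w \<partial>Q)"

definition total_grid_impulse :: "nat \<Rightarrow> ennreal" where
  "total_grid_impulse n = (\<integral>\<^sup>+w. grid_impulse_sum n w \<partial>Q)"

lemma total_grid_impulse_le: "ennreal h * total_grid_impulse n \<le> total_impulse (real n * h)"
  unfolding total_grid_impulse_def total_impulse_def
  by (subst nn_integral_cmult[symmetric]) (auto intro!: nn_integral_mono grid_impulse_sum_le)

lemma total_impulse_le: "ennreal (\<beta> h) * total_impulse (real n * h) \<le> ennreal h * total_grid_impulse n"
  unfolding total_grid_impulse_def total_impulse_def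
  by (subst (1 2) nn_integral_cmult[symmetric]) (auto intro!: nn_integral_mono impulse_sum_le)

lemma total_impulse_step:
  assumes T: "real n * h \<le> T" "T < real (Suc n) * h"
  shows "total_impulse T = total_impulse (real n * h)"
  unfolding total_impulse_def
proof (rule nn_integral_cong)
  fix w assume w: "w \<in> space Q"
  have "\<tau> i w \<le> ennreal T \<longleftrightarrow> \<tau> i w \<le> ennreal (real n * h)" for i
  proof
    assume le: "\<tau> i w \<le> ennreal T"
    show "\<tau> i w \<le> ennreal (real n * h)"
    proof (rule ccontr)
      assume "\<not> ?thesis"
      then have gt: "ennreal (real n * h) < \<tau> i w" by simp
      have "0 \<le> T - real n * h" "T - real n * h < h" using T by (simp_all add: algebra_simps)
      from \<tau>_gap[OF w gt this] le show False by simp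
    qed
  next
    assume "\<tau> i w \<le> ennreal (real n * h)"
    also have "\<dots> \<le> ennreal T" using T by (intro ennreal_leI)
    finally show "\<tau> i w \<le> ennreal T" .
  qed
  then show "impulse_sum T w = impulse_sum (real n * h) w" by (simp add: impulse_sum_def)
qed

text \<open>
  If all impulse times were at most \<open>t\<close>, infinitely many terms of the cost would be at least
  \<open>\<beta>(T) c\<^sub>0\<close>.
\<close>

lemma finitely_many_impulses:
  assumes fin: "total_impulse T < \<infinity>" and t: "0 \<le> t" "t \<le> T"
  shows "AE w in Q. \<exists>j. ennreal t < \<tau> j w"
proof -
  have "AE w in Q. impulse_sum T w \<noteq> \<infinity>"
    using fin unfolding total_impulse_def by (intro nn_integral_PInf_AE) auto
  then show ?thesis
  proof eventually_elim
    case (elim w)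
    show ?case
    proof (rule ccontr)
      assume "\<not> ?thesis"
      then have le: "\<tau> j w \<le> ennreal t" for j by (simp add: not_less)
      have T: "0 \<le> T" and tT: "ennreal t \<le> ennreal T" using t by (auto intro: ennreal_leI)
      have "impulse_sum T w = \<infinity>"
        unfolding impulse_sum_def
      proof (rule ennreal_suminf_ge[where \<epsilon>="\<beta> T * c0"])
        show "0 < \<beta> T * c0" using \<beta>_pos[OF T] c0 by simp
        fix i
        have "\<tau> i w \<le> ennreal T" using le[of i] tT by (rule order_trans)
        then have "enn2real (\<tau> i w) \<le> T" using T by (simp add: enn2real_leI)
        then have "\<beta> T * c0 \<le> \<beta> (enn2real (\<tau> i w)) * imp_cost c X V i w"
          using imp_cost_ge[of i w] c0 less_imp_le[OF \<beta>_pos[of "enn2real (\<tau> i w)"]] by (intro mult_mono \<beta>_antimono) auto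
        then show "ennreal (\<beta> T * c0) \<le> (if \<tau> i w \<le> ennreal T
            then ennreal (\<beta> (enn2real (\<tau> i w)) * imp_cost c X V i w) else 0)"
          using \<open>\<tau> i w \<le> ennreal T\<close> by (simp add: ennreal_leI)
      qed
      with elim show False by simp
    qed
  qed
qed

definition average :: "real \<Rightarrow> ereal" where
  "average T = (ereal (gain T) + enn2ereal (total_impulse T)) / ereal (B T)"

definition grid_average :: "nat \<Rightarrow> ereal" where
  "grid_average n = (ereal (grid_gain n) + enn2ereal (total_grid_impulse n)) / ereal (B (real n * h) / h)"

lemma J_d_eq:
  assumes "PV x V = Q"
  shows "J_d \<beta> g c X PV x V = Limsup at_top average"
  unfolding J_d_def
proof (rule Limsup_eq, rule eventually_mono[OF eventually_ge_at_top[of 0]])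
  fix T :: real assume T: "0 \<le> T"
  have "0 \<le> \<beta> (enn2real (\<tau> i w)) * imp_cost c X V i w" for i w
    using \<beta>_pos[of "enn2real (\<tau> i w)"] imp_cost_nonneg by (intro mult_nonneg_nonneg) auto
  then have sum: "(\<Sum>i. if \<tau> i w \<le> ennreal T then ereal (\<beta> (enn2real (\<tau> i w)) * imp_cost c X V i w) else 0)
      = enn2ereal (impulse_sum T w)" for w
    unfolding impulse_sum_def by (rule suminf_ereal_eq_enn2ereal)
  show "ereal_expectation (PV x V) (\<lambda>w. ereal (LINT s:{0..T}|lborel. \<beta> s * g (Y s w)) +
      (\<Sum>i. if \<tau> i w \<le> ennreal T then ereal (\<beta> (enn2real (\<tau> i w)) * imp_cost c X V i w) else 0))
      / ereal (LINT s:{0..T}|lborel. \<beta> s) = average T"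
    unfolding assms sum
    by (subst ereal_expectation_add[OF gain_eq(1)[OF T] measurable_impulse_sum])
      (simp add: average_def gain_eq(2)[OF T] total_impulse_def B_def)
qed

lemma J_d_grid_eq:
  assumes "PV x V = Q"
  shows "J_d_grid \<beta> g c X PV h x V = limsup grid_average"
  unfolding J_d_grid_def
proof (rule arg_cong[where f=limsup], rule ext)
  fix n
  have "0 \<le> (1 / h) * phi \<beta> h (enn2real (\<tau> i w) / h) * imp_cost c X V i w" for i w
    using h less_imp_le[OF phi_bounds(3)[OF h, of "enn2real (\<tau> i w)"]] imp_cost_nonneg
    by (intro mult_nonneg_nonneg) auto
  then have sum: "(\<Sum>i. if \<tau> i w \<le> ennreal (real n * h)
      then ereal ((1 / h) * phi \<beta> h (enn2real (\<tau> i w) / h) * imp_cost c X V i w) else 0)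
      = enn2ereal (grid_impulse_sum n w)" for w
    unfolding grid_impulse_sum_def by (rule suminf_ereal_eq_enn2ereal)
  show "ereal_expectation (PV x V) (\<lambda>w. ereal (\<Sum>i<n. phi \<beta> h (real i) * g (Y (real i * h) w)) +
      (\<Sum>i. if \<tau> i w \<le> ennreal (real n * h)
        then ereal ((1 / h) * phi \<beta> h (enn2real (\<tau> i w) / h) * imp_cost c X V i w) else 0))
      / ereal (\<Sum>i<n. phi \<beta> h (real i)) = grid_average n"
    unfolding assms sum
    by (subst ereal_expectation_add[OF grid_gain_eq(1) measurable_grid_impulse_sum])
      (simp add: grid_average_def grid_gain_eq(2) total_grid_impulse_def sum_phi[OF h])
qed

lemma quotient_lessE:
  assumes "0 < d" and "(ereal a + enn2ereal i) / ereal d < ereal r"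
  obtains i' where "0 \<le> i'" "i = ennreal i'" "a + i' < r * d"
proof (cases i)
  case (real i')
  with assms show ?thesis by (intro that[of i']) (auto simp: pos_divide_less_eq)
next
  case top
  with assms show ?thesis by simp
qed

lemma grid_average_le:
  assumes n: "0 < n" and less: "average (real n * h) < ereal r"
  shows "grid_average n \<le> ereal (r + \<delta>)"
proof -
  have b: "0 < B (real n * h)" using n h by (intro B_pos) simp
  obtain i where i: "0 \<le> i" "total_impulse (real n * h) = ennreal i" "gain (real n * h) + i < r * B (real n * h)"
    by (rule quotient_lessE[OF b less[unfolded average_def]])
  have "ennreal h * total_grid_impulse n \<le> ennreal i"
    using total_grid_impulse_le[of n] i(2) by simp
  moreover have "total_grid_impulse n \<noteq> \<top>"
    using calculation h by (auto simp: ennreal_mult_top top_unique)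
  ultimately obtain k where k: "0 \<le> k" "total_grid_impulse n = ennreal k" "h * k \<le> i"
    using h i(1) by (cases "total_grid_impulse n") (auto simp: ennreal_mult'[symmetric])
  have "\<bar>gain (real n * h) - h * grid_gain n\<bar> \<le> \<delta> * B (real n * h)"
    using h i(2) by (intro gain_grid_gain finitely_many_impulses[of "real n * h"]) auto
  with i(3) k(3) have "h * grid_gain n + h * k \<le> (r + \<delta>) * B (real n * h)"
    by (simp add: distrib_right)
  then have "(grid_gain n + k) / (B (real n * h) / h) \<le> r + \<delta>"
    using h b by (simp add: field_simps)
  then show ?thesis unfolding grid_average_def k(2) using k(1) h b by simp
qed

text \<open>
  Adding \<open>M\<close> to the running gain makes the numerators nonnegative; this allows the factor \<open>1/\<beta>(h)\<close>,
  which only the impulse cost needs, to be put in front of the whole numerator. The error \<open>\<epsilon>\<close> pays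
  for the running gain over the incomplete last step.
\<close>

lemma average_le:
  assumes n: "0 < n" and T: "real n * h \<le> T" "T < real (Suc n) * h"
    and large: "2 * M * h \<le> \<epsilon> * B T"
    and less: "grid_average n < ereal r"
  shows "average T \<le> ereal ((r + M) / \<beta> h + \<delta> - M + \<epsilon>)"
proof -
  define b where "b = B (real n * h)"
  define b' where "b' = B T"
  have nh: "0 < real n * h" using n h by simp
  have b: "0 < b" unfolding b_def using nh by (rule B_pos)
  have b': "b \<le> b'" "b' \<le> b + h"
  proof -
    show "b \<le> b'" unfolding b_def b'_def using nh T by (intro B_mono) auto
    have "b' \<le> b + (T - real n * h)"
      unfolding b_def b'_def using nh T by (intro B_le_add) auto
    then show "b' \<le> b + h" using T by (simp add: algebra_simps)
  qed
  have \<beta>: "0 < \<beta> h" using h by (simp add: \<beta>_pos)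
  from less[unfolded grid_average_def] b h
  obtain k where k: "0 \<le> k" "total_grid_impulse n = ennreal k" "grid_gain n + k < r * (b / h)"
    by (metis b_def divide_pos_pos quotient_lessE)
  have k3: "h * grid_gain n + h * k < r * b"
    using k(3) h by (simp add: field_simps)
  have "ennreal (\<beta> h) * total_impulse (real n * h) \<le> ennreal (h * k)"
    using total_impulse_le[of n] k h by (simp add: ennreal_mult'[symmetric])
  moreover have "total_impulse (real n * h) \<noteq> \<top>"
    using calculation \<beta> by (auto simp: ennreal_mult_top top_unique)
  ultimately obtain i where i: "0 \<le> i" "total_impulse (real n * h) = ennreal i" "\<beta> h * i \<le> h * k"
    using h k(1) \<beta> by (cases "total_impulse (real n * h)") (auto simp: ennreal_mult'[symmetric])
  have "\<bar>gain (real n * h) - h * grid_gain n\<bar> \<le> \<delta> * b"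
    unfolding b_def using h i(2) by (intro gain_grid_gain finitely_many_impulses[of "real n * h"]) auto
  moreover have "\<bar>gain T - gain (real n * h)\<bar> \<le> M * (b' - b)"
    using gain_increment[of "real n * h" T 0 M] nh T mean_gain_bound by (simp add: b_def b'_def)
  ultimately have gain: "gain T \<le> h * grid_gain n + \<delta> * b + M * (b' - b)" by linarith
  have nonneg: "0 \<le> h * grid_gain n + M * b"
    using grid_gain_bound[of n] by (simp add: b_def)
  define W where "W = (r + M) / \<beta> h"
  have W: "r + M = \<beta> h * W" using \<beta> by (simp add: W_def)
  have "\<beta> h * (h * grid_gain n + M * b + i) \<le> h * grid_gain n + M * b + h * k"
    using i(3) mult_left_le_one_le[OF nonneg, of "\<beta> h"] \<beta> \<beta>_le_1[of h] h by (simp add: distrib_left)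
  also have "\<dots> \<le> (r + M) * b" using k3 by (simp add: distrib_right)
  also have "\<dots> = \<beta> h * (W * b)" by (simp add: W)
  finally have main: "h * grid_gain n + M * b + i \<le> W * b" using \<beta> by simp
  have "0 \<le> h * k" using h k(1) by simp
  then have "0 \<le> (r + M) * b" unfolding distrib_right using k3 nonneg by linarith
  then have "0 \<le> W" using b \<beta> by (simp add: W zero_le_mult_iff)
  have \<delta>: "0 \<le> \<delta>" using deviation[of 0 x] h by linarith
  have "gain T + i \<le> W * b + \<delta> * b - M * b + M * (b' - b)" using gain main by linarith
  also have "\<dots> \<le> W * b' + \<delta> * b' - M * b + M * (b' - b)"
    using \<open>0 \<le> W\<close> \<delta> b' by (intro add_right_mono diff_right_mono add_mono mult_left_mono) auto
  also have "\<dots> = (W + \<delta> - M) * b' + 2 * M * (b' - b)" by (simp add: algebra_simps)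
  also have "\<dots> \<le> (W + \<delta> - M) * b' + 2 * M * h"
    using b' M_nonneg by (intro add_left_mono mult_left_mono) auto
  also have "\<dots> \<le> (W + \<delta> - M) * b' + \<epsilon> * b'" using large by (simp add: b'_def)
  finally have "gain T + i \<le> (W + \<delta> - M + \<epsilon>) * b'" by (simp add: distrib_right)
  then have "(gain T + i) / b' \<le> W + \<delta> - M + \<epsilon>"
    using b b' by (simp add: pos_divide_le_eq)
  then show ?thesis
    unfolding average_def total_impulse_step[OF T] i(2)
    using i(1) b b' by (simp add: b'_def W_def)
qed

lemma filterlim_grid: "filterlim (\<lambda>n. real n * h) at_top sequentially"
  using h filterlim_tendsto_pos_mult_at_top[OF tendsto_const h filterlim_real_sequentially]
  by (simp add: mult.commute)

lemma Limsup_grid_average_le: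
  assumes "Limsup at_top average < ereal r"
  shows "limsup grid_average \<le> ereal (r + \<delta>)"
proof (rule Limsup_bounded)
  have "\<forall>\<^sub>F T in at_top. average T < ereal r"
    using assms by (rule Limsup_lessD)
  then have "\<forall>\<^sub>F n in sequentially. average (real n * h) < ereal r"
    using filterlim_grid by (rule eventually_compose_filterlim)
  then show "\<forall>\<^sub>F n in sequentially. grid_average n \<le> ereal (r + \<delta>)"
    using eventually_gt_at_top[of 0] by eventually_elim (rule grid_average_le)
qed

lemma Limsup_average_le:
  assumes less: "limsup grid_average < ereal r" and \<epsilon>: "0 < \<epsilon>"
  shows "Limsup at_top average \<le> ereal ((r + M) / \<beta> h + \<delta> - M + \<epsilon>)"
proof (rule Limsup_bounded)
  have "filterlim (\<lambda>T. nat \<lfloor>T / h\<rfloor>) at_top at_top"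
  proof (rule filterlim_compose[OF filterlim_nat_sequentially filterlim_compose[OF filterlim_floor_sequentially]])
    show "filterlim (\<lambda>T. T / h) at_top at_top"
      using h filterlim_tendsto_pos_mult_at_top[OF tendsto_const[of "1 / h"] _ filterlim_ident]
      by (simp add: mult.commute)
  qed
  moreover have "\<forall>\<^sub>F n in sequentially. 0 < n \<and> grid_average n < ereal r"
    using Limsup_lessD[OF less] eventually_gt_at_top[of 0] by eventually_elim simp
  ultimately have "\<forall>\<^sub>F T in at_top. 0 < nat \<lfloor>T / h\<rfloor> \<and> grid_average (nat \<lfloor>T / h\<rfloor>) < ereal r"
    by (rule eventually_compose_filterlim[rotated])
  moreover have "\<forall>\<^sub>F T in at_top. 2 * M * h / \<epsilon> \<le> B T"
    using B_at_top by (simp add: filterlim_at_top)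
  moreover have "\<forall>\<^sub>F T in at_top. (0::real) \<le> T" by (rule eventually_ge_at_top)
  ultimately show "\<forall>\<^sub>F T in at_top. average T \<le> ereal ((r + M) / \<beta> h + \<delta> - M + \<epsilon>)"
  proof eventually_elim
    case (elim T)
    define n where "n = nat \<lfloor>T / h\<rfloor>"
    have n: "real n = real_of_int \<lfloor>T / h\<rfloor>" using elim h by (simp add: n_def)
    have "real n \<le> T / h" "T / h < real n + 1" unfolding n by linarith+
    then have "real n * h \<le> T" "T < real (Suc n) * h" using h by (simp_all add: field_simps)
    moreover have "2 * M * h \<le> \<epsilon> * B T" using elim \<epsilon> by (simp add: field_simps)
    ultimately show ?case using elim unfolding n_def[symmetric] by (intro average_le) auto
  qed
qed

lemma limsup_grid_average_ge: "ereal (- M) \<le> limsup grid_average"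
proof -
  have "ereal (- M) \<le> grid_average n" if "0 < n" for n
  proof -
    have b: "0 < B (real n * h)" using that h by (intro B_pos) simp
    have "- M \<le> h * grid_gain n / B (real n * h)"
      using grid_gain_bound[of n] b by (simp add: pos_le_divide_eq abs_le_iff)
    then have "- M \<le> grid_gain n / (B (real n * h) / h)"
      by (simp add: mult.commute)
    then have "ereal (- M) \<le> ereal (grid_gain n) / ereal (B (real n * h) / h)"
      using h b by simp
    also have "\<dots> \<le> grid_average n"
      unfolding grid_average_def using h b
      by (intro ereal_divide_right_mono) (auto simp: add_increasing2)
    finally show ?thesis .
  qed
  then have "\<forall>\<^sub>F n in sequentially. ereal (- M) \<le> grid_average n"
    by (rule eventually_mono[OF eventually_gt_at_top])
  then show ?thesis
    using Liminf_bounded[of "ereal (- M)" grid_average sequentially] Liminf_le_Limsup[of sequentially grid_average]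
    by (simp add: order_trans)
qed

lemma limsup_grid_average_le_of_no_impulses:
  assumes "\<And>i w. \<tau> i w = \<infinity>"
  shows "limsup grid_average \<le> ereal M"
proof (rule Limsup_bounded, rule eventually_mono[OF eventually_gt_at_top])
  fix n :: nat assume "0 < n"
  then have b: "0 < B (real n * h)" using h by (intro B_pos) simp
  have "total_grid_impulse n = 0"
    by (simp add: total_grid_impulse_def grid_impulse_sum_def assms top_unique)
  moreover have "h * grid_gain n / B (real n * h) \<le> M"
    using grid_gain_bound[of n] b by (simp add: pos_divide_le_eq abs_le_iff)
  ultimately show "grid_average n \<le> ereal M"
    using h b by (simp add: grid_average_def zero_ennreal.rep_eq mult.commute)
qed

end

section \<open>Comparison of the optimal values\<close>

lemma no_impulse_strategy:
  "(\<lambda>_. (\<lambda>_. \<infinity>, \<lambda>_. y)) \<in> grid_strategies F h"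
  by (auto simp: grid_strategies_def strategies_def stopping_time_const)

text \<open>
  For one direction take a nearly optimal strategy for \<open>J\<^sup>d\<^sub>h\<close> and use it for \<open>J\<^sup>d\<close>, for the other
  direction conversely. The strategy without impulses bounds the infimum of \<open>J\<^sup>d\<^sub>h\<close> by \<open>M\<close>, and this
  turns the factor \<open>1/\<beta>(h)\<close> into the additive error \<open>2 M (1/\<beta>(h) - 1)\<close>.
\<close>

lemma grid_values_close:
  fixes F :: "ennreal \<Rightarrow> 'w measure"
    and X :: "real \<Rightarrow> 'w \<Rightarrow> 'e::{metric_space, second_countable_topology}"
  assumes process: "standard_process F X \<theta> P"
    and laws: "\<And>V. V \<in> strategies F \<Longrightarrow> controlled_law F X P x V (PV x V)"
    and discount: "discount \<beta>"
    and g: "g \<in> borel_measurable borel" "\<And>y. \<bar>g y\<bar> \<le> M"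
    and c: "(\<lambda>(y, z). c y z) \<in> borel_measurable (borel \<Otimes>\<^sub>M borel)" "\<And>y z. c0 \<le> c y z" "0 < c0"
    and h: "0 < h" and \<delta>: "0 < \<delta>"
    and deviation: "\<And>s y. 0 \<le> s \<Longrightarrow> s \<le> h \<Longrightarrow> \<bar>(\<integral>\<omega>. g (X s \<omega>) \<partial>P y) - g y\<bar> \<le> \<delta>"
  shows "\<bar>(INF V\<in>grid_strategies F h. J_d_grid \<beta> g c X PV h x V)
      - (INF V\<in>grid_strategies F h. J_d \<beta> g c X PV x V)\<bar>
    \<le> ereal (2 * M * (1 / \<beta> h - 1) + \<delta> / \<beta> h + 2 * \<delta>)"
proof -
  interpret discount \<beta> by fact
  have cost: "grid_impulse_cost F X \<theta> P V h x (PV x V) \<beta> g c M c0 \<delta>" if "V \<in> grid_strategies F h" for V :: "('w, 'e) strategy"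
  proof -
    interpret standard_process F X \<theta> P by fact
    show ?thesis
      by unfold_locales
        (use that laws h g c deviation in \<open>auto simp: grid_strategies_def\<close>)
  qed
  define a where "a = (INF V\<in>grid_strategies F h. J_d_grid \<beta> g c X PV h x V)"
  define b where "b = (INF V\<in>grid_strategies F h. J_d \<beta> g c X PV x V)"
  have \<beta>h: "0 < \<beta> h" "\<beta> h \<le> 1" using h by (simp_all add: \<beta>_pos \<beta>_le_1)
  have "ereal (- M) \<le> a"
    unfolding a_def
  proof (rule INF_greatest)
    fix V :: "('w, 'e) strategy" assume "V \<in> grid_strategies F h"
    then interpret grid_impulse_cost F X \<theta> P V h x "PV x V" \<beta> g c M c0 \<delta> by (rule cost)
    show "ereal (- M) \<le> J_d_grid \<beta> g c X PV h x V"
      unfolding J_d_grid_eq[of PV, OF refl] by (rule limsup_grid_average_ge)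
  qed
  moreover have "a \<le> ereal M"
    unfolding a_def
  proof (rule INF_lower2[OF no_impulse_strategy])
    interpret grid_impulse_cost F X \<theta> P "\<lambda>_. (\<lambda>_. \<infinity>, \<lambda>_. x)" h x "PV x (\<lambda>_. (\<lambda>_. \<infinity>, \<lambda>_. x))" \<beta> g c M c0 \<delta>
      by (rule cost[OF no_impulse_strategy])
    show "J_d_grid \<beta> g c X PV h x (\<lambda>_. (\<lambda>_. \<infinity>, \<lambda>_. x)) \<le> ereal M"
      unfolding J_d_grid_eq[of PV, OF refl] by (rule limsup_grid_average_le_of_no_impulses) simp
  qed
  ultimately obtain a' where a': "a = ereal a'" "- M \<le> a'" "a' \<le> M"
    by (cases a) auto
  have upper: "b \<le> ereal ((a' + \<delta> + M) / \<beta> h + \<delta> - M + \<delta>)"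
  proof -
    have "a < ereal (a' + \<delta>)" using \<delta> a' by simp
    then obtain V where in_grid: "V \<in> grid_strategies F h" and less: "J_d_grid \<beta> g c X PV h x V < ereal (a' + \<delta>)"
      unfolding a_def by (auto simp: INF_less_iff)
    interpret grid_impulse_cost F X \<theta> P V h x "PV x V" \<beta> g c M c0 \<delta> by (rule cost[OF in_grid])
    have "b \<le> J_d \<beta> g c X PV x V" unfolding b_def by (rule INF_lower[OF in_grid])
    also have "\<dots> \<le> ereal ((a' + \<delta> + M) / \<beta> h + \<delta> - M + \<delta>)"
      unfolding J_d_eq[of PV, OF refl] using less \<delta> unfolding J_d_grid_eq[of PV, OF refl] by (rule Limsup_average_le)
    finally show ?thesis .
  qed
  have lower: "ereal (a' - 2 * \<delta>) \<le> b"
  proof (rule ccontr)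
    assume "\<not> ?thesis"
    then obtain V where in_grid: "V \<in> grid_strategies F h" and less: "J_d \<beta> g c X PV x V < ereal (a' - 2 * \<delta>)"
      unfolding b_def by (auto simp: not_le INF_less_iff)
    interpret grid_impulse_cost F X \<theta> P V h x "PV x V" \<beta> g c M c0 \<delta> by (rule cost[OF in_grid])
    have "a \<le> J_d_grid \<beta> g c X PV h x V" unfolding a_def by (rule INF_lower[OF in_grid])
    also have "\<dots> \<le> ereal (a' - 2 * \<delta> + \<delta>)"
      unfolding J_d_grid_eq[of PV, OF refl] using less unfolding J_d_eq[of PV, OF refl] by (rule Limsup_grid_average_le)
    finally show False using a' \<delta> by simp
  qed
  obtain b' where b': "b = ereal b'" "a' - 2 * \<delta> \<le> b'" "b' \<le> (a' + \<delta> + M) / \<beta> h + \<delta> - M + \<delta>"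
    using upper lower by (cases b) auto
  have one: "0 \<le> 1 / \<beta> h - 1" using \<beta>h by simp
  have "(a' + M) * (1 / \<beta> h - 1) \<le> 2 * M * (1 / \<beta> h - 1)"
    using one a' by (intro mult_right_mono) auto
  moreover have "(a' + \<delta> + M) / \<beta> h = (a' + M) * (1 / \<beta> h - 1) + (a' + M) + \<delta> / \<beta> h"
    by (simp add: add_divide_distrib algebra_simps)
  ultimately have "b' - a' \<le> 2 * M * (1 / \<beta> h - 1) + \<delta> / \<beta> h + 2 * \<delta>"
    using b'(3) by linarith
  moreover have "0 \<le> 2 * M * (1 / \<beta> h - 1)" using one a' by (intro mult_nonneg_nonneg) auto
  moreover have "0 \<le> \<delta> / \<beta> h" using \<delta> \<beta>h by simp
  ultimately have "\<bar>a' - b'\<bar> \<le> 2 * M * (1 / \<beta> h - 1) + \<delta> / \<beta> h + 2 * \<delta>"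
    using b'(2) by linarith
  then show ?thesis unfolding a_def[symmetric] b_def[symmetric] a'(1) b'(1) by simp
qed

theorem theorem4p2:
  fixes F :: "ennreal \<Rightarrow> 'w measure"
    and X :: "real \<Rightarrow> 'w \<Rightarrow> 'e::{metric_space, second_countable_topology}"
    and \<theta> :: "real \<Rightarrow> 'w \<Rightarrow> 'w"
    and P :: "'e \<Rightarrow> 'w measure"
    and PV :: "'e \<Rightarrow> ('w, 'e) strategy \<Rightarrow> (nat \<Rightarrow> 'w) measure"
    and \<beta> :: "real \<Rightarrow> real"
    and g :: "'e \<Rightarrow> real"
    and c :: "'e \<Rightarrow> 'e \<Rightarrow> real"
    and c0 :: real
  assumes compact_E: "compact (UNIV :: 'e set)"
    and process: "standard_process F X \<theta> P"
    and controlled_laws: "\<forall>x. \<forall>V\<in>strategies F. controlled_law F X P x V (PV x V)"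
    and \<beta>_range: "\<forall>t\<ge>0. 0 < \<beta> t \<and> \<beta> t \<le> 1"
    and \<beta>_decreasing: "\<forall>s t. 0 \<le> s \<longrightarrow> s \<le> t \<longrightarrow> \<beta> t \<le> \<beta> s"
    and \<beta>_continuous: "continuous_on {0..} \<beta>"
    and \<beta>_zero: "\<beta> 0 = 1"
    and \<beta>_supermult: "\<forall>s\<ge>0. \<forall>t\<ge>0. \<beta> (t + s) \<ge> \<beta> t * \<beta> s"
    and \<beta>_integral: "(\<integral>\<^sup>+ s\<in>{0..}. ennreal (\<beta> s) \<partial>lborel) = \<infinity>"
    and g_continuous: "continuous_on UNIV g"
    and g_bounded: "bounded (range g)"
    and c_continuous: "continuous_on UNIV (\<lambda>(x, \<xi>). c x \<xi>)"
    and c_bounded: "bounded (range (\<lambda>(x, \<xi>). c x \<xi>))"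
    and c0_pos: "0 < c0"
    and c_lower: "\<forall>x \<xi>. c0 \<le> c x \<xi>"
    and c_triangle: "\<forall>x \<xi> \<eta>. c x \<xi> \<le> c x \<eta> + c \<eta> \<xi>"
    and Feller: "\<forall>f::'e \<Rightarrow> real. \<forall>t>0. continuous_on UNIV f \<longrightarrow> bounded (range f) \<longrightarrow>
      continuous_on UNIV (\<lambda>x. \<integral>\<omega>. f (X t \<omega>) \<partial>P x) \<and>
      bounded (range (\<lambda>x. \<integral>\<omega>. f (X t \<omega>) \<partial>P x))"
    and mixing: "\<forall>t>0. \<exists>\<Lambda>. 0 < \<Lambda> \<and> \<Lambda> < 1 \<and> (\<forall>x y. \<forall>A\<in>sets borel.
      \<bar>transition X P t x A - transition X P t y A\<bar> \<le> \<Lambda>)"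
  shows "\<forall>x. ((\<lambda>h. \<bar>(INF V\<in>grid_strategies F h. J_d_grid \<beta> g c X PV h x V)
                   - (INF V\<in>grid_strategies F h. J_d \<beta> g c X PV x V)\<bar>) \<longlongrightarrow> 0) (at_right 0)"
proof
  fix x
  interpret standard_process F X \<theta> P by (rule process)
  have discount: "discount \<beta>"
    using \<beta>_range \<beta>_decreasing \<beta>_continuous \<beta>_supermult \<beta>_integral by unfold_locales auto
  obtain M where M: "\<And>y. \<bar>g y\<bar> \<le> M"
    using g_bounded unfolding bounded_iff by auto
  have g: "g \<in> borel_measurable borel"
    using g_continuous by (rule borel_measurable_continuous_onI)
  have c: "(\<lambda>(y, z). c y z) \<in> borel_measurable (borel \<Otimes>\<^sub>M borel)"
    unfolding borel_prod using c_continuous by (rule borel_measurable_continuous_onI)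
  have Feller': "continuous_on UNIV (semigroup_op t f)" if "continuous_on UNIV f" "0 < t"
    for f :: "'e \<Rightarrow> real" and t
    using Feller that compact_imp_bounded[OF compact_continuous_image[OF that(1) compact_E]] by blast
  have "(\<beta> \<longlongrightarrow> \<beta> 0) (at 0 within {0..})"
    using \<beta>_continuous by (simp add: continuous_on)
  then have \<beta>_right: "(\<beta> \<longlongrightarrow> 1) (at_right 0)"
    using \<beta>_zero by (auto intro: tendsto_within_subset)
  show "((\<lambda>h. \<bar>(INF V\<in>grid_strategies F h. J_d_grid \<beta> g c X PV h x V)
      - (INF V\<in>grid_strategies F h. J_d \<beta> g c X PV x V)\<bar>) \<longlongrightarrow> 0) (at_right 0)"
  proof (rule order_tendstoI)
    fix l :: ereal assume "l < 0"
    then show "\<forall>\<^sub>F h in at_right 0. l < \<bar>(INF V\<in>grid_strategies F h. J_d_grid \<beta> g c X PV h x V)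
        - (INF V\<in>grid_strategies F h. J_d \<beta> g c X PV x V)\<bar>"
      by (intro always_eventually allI) (auto intro: less_le_trans)
  next
    fix u :: ereal assume "0 < u"
    then obtain e where e: "0 < e" "ereal e < u"
      by (metis ereal_dense2 ereal_less(2))
    \<comment> \<open>the bound of \<open>grid_values_close\<close> tends to \<open>3 \<delta> < e\<close> as \<open>h \<rightarrow> 0\<close>\<close>
    define \<delta> where "\<delta> = e / 4"
    have \<delta>: "0 < \<delta>" using e by (simp add: \<delta>_def)
    obtain d where d: "0 < d" "\<And>s y. 0 \<le> s \<Longrightarrow> s \<le> d \<Longrightarrow> \<bar>semigroup_op s g y - g y\<bar> \<le> \<delta>"
      using semigroup_uniformly_continuous[OF compact_E Feller' g_continuous \<delta>] by blast
    have "((\<lambda>h. 2 * M * (1 / \<beta> h - 1) + \<delta> / \<beta> h + 2 * \<delta>) \<longlongrightarrow> 2 * M * (1 / 1 - 1) + \<delta> / 1 + 2 * \<delta>) (at_right 0)"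
      by (intro tendsto_intros \<beta>_right) auto
    moreover have "2 * M * (1 / 1 - 1) + \<delta> / 1 + 2 * \<delta> < e" using e by (simp add: \<delta>_def)
    ultimately have "\<forall>\<^sub>F h in at_right 0. 2 * M * (1 / \<beta> h - 1) + \<delta> / \<beta> h + 2 * \<delta> < e"
      by (rule order_tendstoD)
    moreover have "\<forall>\<^sub>F h in at_right 0. h \<in> {0<..<d}"
      using d(1) by (rule eventually_at_right_real)
    ultimately show "\<forall>\<^sub>F h in at_right 0. \<bar>(INF V\<in>grid_strategies F h. J_d_grid \<beta> g c X PV h x V)
        - (INF V\<in>grid_strategies F h. J_d \<beta> g c X PV x V)\<bar> < u"
    proof eventually_elim
      case (elim h)
      have "\<bar>(INF V\<in>grid_strategies F h. J_d_grid \<beta> g c X PV h x V)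
          - (INF V\<in>grid_strategies F h. J_d \<beta> g c X PV x V)\<bar>
        \<le> ereal (2 * M * (1 / \<beta> h - 1) + \<delta> / \<beta> h + 2 * \<delta>)"
        by (rule grid_values_close[OF process _ discount g M c _ c0_pos _ \<delta>])
          (use controlled_laws c_lower elim d(2) in auto)
      also have "\<dots> < ereal e" using elim by simp
      also have "\<dots> < u" by (rule e(2))
      finally show ?case .
    qed
  qed
qed

end
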